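(* Consider the QCD $L$-$Q$ pair $L_1=\tfrac12\langle F^{\mu\nu}|i[A_\mu,A_\nu]\rangle+\langle A_\mu|j^\mu\rangle$, $Q_1^\mu=\langle F^{\mu\nu}|i[w,A_\nu]\rangle+\langle w|j^\mu\rangle$, with second-order interaction $L_2=-\tfrac12(1+c_F)\langle i[A^\mu,A^\nu]|i[A_\mu,A_\nu]\rangle$ and $Q_2=Q_2|_\delta+Q_2|_{I\delta}$, where $$Q_2^\mu|_\delta(x;x')=-2(1+c_F)\langle i[A^\mu,A^\nu]|i[w,A_\nu]\rangle\cdot\delta_{xx'},\qquad Q_2^\mu|_{I\delta}(x;x')=2\Big\langle\frac{\partial Q_1^\mu}{\partial w}(x)\Big|w_2(x,x')\Big\rangle .$$ Then the contribution to the third-order obstruction without string-integrated delta functions, $$O_{Q_1(x)}(L_2(x'))|_\delta\cdot\delta_{x'x''}+O_{Q_2(x;x')|_\delta}(L_1(x''))|_\delta\qquad\text{(symmetrized in }x,x',x''),$$ is identically zero. Consequently, provided the two remaining contributions $$\mathfrak S_{xx'x''}\Big[\Big\langle w_2(x,x')\Big|O\Big(\frac{\partial Q_2}{\partial w_2},L_1''\Big)\Big\rangle+O_{Q_1}(L_2')|_{I\delta}\cdot\delta_{x'x''}\Big]$$ and $$\mathfrak S_{xx'x''}\Big[\Big\langle\frac{\partial Q_2}{\partial w_2}\Big|O(w_2,L_1'')\Big\rangle+O_{Q_2(x;x')|_\delta}(L_1'')|_{I\delta}\Big]$$ are total derivatives, the third-order condition $$3\,\mathfrak S_{xx'x''}\big(O_{Q_1}(L_2')\cdot\delta_{x'x''}+O_{Q_2(x;x')}(L_1'')\big)=\delta_cL_3\cdot\delta_{xx'x''}-\mathfrak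 S_{xx'x''}\partial_\mu Q_3^\mu(x;x',x'')$$ is solved with $L_3=0$ and $Q_3|_\delta=0$.
   Context: Lie algebra: a simple non-abelian Lie algebra with generators $\xi_a$, $[\xi_a,\xi_b]=if_{abc}\xi_c$, $f_{abc}$ real and totally antisymmetric; symmetric inner product $\langle\xi_a|\xi_b\rangle=\delta_{ab}$, invariant: $\langle i[X,Z]|Y\rangle=\langle X|i[Z,Y]\rangle$. Fields are Lie-algebra valued, $X=X^a\xi_a$; products of components are Wick products (bosonic components commute), and $[\cdot,\cdot]$, $\langle\cdot|\cdot\rangle$ refer only to the Lie algebra. Fields on Minkowski space (metric $\eta$): $F_{\mu\nu}=-F_{\nu\mu}$, the string-localized potential $A_\mu=A_\mu(c)$, and $w$, with $\partial^\mu F_{\mu\nu}=0$, $\partial_\mu A_\nu-\partial_\nu A_\mu=F_{\mu\nu}$, $\partial^\mu A_\mu=0$; conserved quark currents $j^\mu=j^\mu_a\xi_a$. Here $c(e)$ is a smearing function of total weight 1 on spacelike unit vectors, $(I^\nu f)(x)=\int d\sigma(e)\,c(e)e^\nu\int_0^\infty ds\,f(x+se)$ (so $\partial_\nu I^\nu=-1$), $A_\mu=I^\nu F_{\mu\nu}$. $\delta_c$ is a derivation with $\delta_cA_\mu=\partial_\mu w$, $\delta_cF=0$, $\delta_cj=0$. $w_2(x,x'):=i[w(x'),A_\nu(x')]\cdot I^\nu\delta_{xx'}$. Notation: $\delta_{xx'}=\delta(x-x')$, $\delta_{xx'x''}=\delta_{xx'}\delta_{x'x''}$; primes on a field or on $I$,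 $\partial$ indicate the argument $x'$, $x''$; $T^{[\kappa}S^{\lambda]}=T^\kappa S^\lambda-T^\lambda S^\kappa$; $\mathfrak S$ is the average over permutations of the indicated arguments. $|_\delta$ and $|_{I\delta}$ denote the parts without, respectively with, string-integrated delta functions. A total derivative is an expression of the form $\mathfrak S_{xx'x''}\partial^x_\mu U^\mu(x;x',x'')$. Obstruction map (tree level): $O_{Y}(X')$ is the sum over all ways of replacing one factor $\varphi$ in $Y^\mu(x)$ and one factor $\chi$ in $X(x')$ ($\varphi,\chi$ among $F,A,w,j$) by the two-point obstruction $O_\mu(\varphi(x),\chi(x'))$. For $Y$ multiplied by $\delta_{xx'}$ the rule is $\mathfrak S_{xx'}O_{Y\cdot\delta_{xx'}}(X'')=\tfrac12O_Y(X'')\cdot\delta_{xx'}$. For $Q_2|_{I\delta}$ the obstruction splits as $O_{Q_2|_{I\delta}}(L_1'')=\langle\frac{\partial Q_2}{\partial w_2}|O(w_2,L_1'')\rangle+\langle w_2|O(\frac{\partial Q_2}{\partial w_2},L_1'')\rangle$, where the first (second) term collects the contributions in which a field inside $w_2$ (inside the coefficient of $w_2$ at $x$) is contracted with $L_1''$; no further evaluation rule for the first term is assumed. Two-point obstructions, with a constant $c_F\in\mathbb R$ (gluonic ones times $\delta_{ab}$): $O_\mu(F^{\mu\nu},F'^{\kappa\lambda})=-(1+c_F)\eta^{\nu[\kappa}\partial^{\lambda]}i\delta_{xx'}$; $O_\mu(F^{\mu\nu},A'^\kappa)=-(\eta^{\nu\kappa}-I'^\nu\partial^\kappa)i\delta_{xx'}$;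 $O_\mu(A_\nu,\cdot)-O_\nu(A_\mu,\cdot)$ equals $-c_F\delta_\mu^{[\kappa}\delta_\nu^{\lambda]}i\delta_{xx'}$ for $F'^{\kappa\lambda}$ and $0$ for $A'^\kappa$; $O_\mu(A^\mu,F'^{\kappa\lambda})=-I^{[\kappa}\partial^{\lambda]}i\delta_{xx'}$ and $O_\mu(A^\mu,A'^\kappa)=-(I^\kappa-I_\nu I'^\nu\partial^\kappa)i\delta_{xx'}$; $O_\mu(w,\cdot)=0$; $O_\mu(j_a^\mu,j_b'^\kappa)=-f_{abc}j_c^\kappa i\delta_{xx'}$; those between a gluonic field and $j$ vanish. The full $O_\mu(A_\nu,\cdot)$ is constrained by scaling dimension (3 for $A'$, 4 for $F'$; $\delta$ has dimension 4) and covariance: the $\delta$-part of $O_\mu(A_\nu,A'^\kappa)$ is zero, and the $\delta$-part of $O_\mu(A_\nu,F'^{\kappa\lambda})$ is a constant multiple of $\delta_\mu^{[\kappa}\delta_\nu^{\lambda]}i\delta_{xx'}$. *)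

theory Defs
  imports "HOL-Analysis.Analysis" "HOL-Library.Poly_Mapping" "HOL-Library.Multiset"
begin

section \<open>The Lie algebra\<close>

text \<open>
  A Lie algebra with generators \<open>xi_a\<close> (indexed by a finite type), \<open>[xi_a, xi_b] = i f_abc xi_c\<close> and
  orthonormal \<open>xi_a\<close>. On real coordinates \<open>i[X,Y]\<close> has components \<open>- f_abc X^a Y^b\<close>; simplicity
  is that of the real Lie algebra with this bracket.
\<close>

definition real_ibracket :: "('g::finite \<Rightarrow> 'g \<Rightarrow> 'g \<Rightarrow> real) \<Rightarrow> real^'g \<Rightarrow> real^'g \<Rightarrow> real^'g" where
  "real_ibracket f X Y = (\<chi> c. - (\<Sum>a\<in>UNIV. \<Sum>b\<in>UNIV. f a b c * X $ a * Y $ b))"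

definition lie_ideal :: "('g::finite \<Rightarrow> 'g \<Rightarrow> 'g \<Rightarrow> real) \<Rightarrow> (real^'g) set \<Rightarrow> bool" where
  "lie_ideal f V \<longleftrightarrow> subspace V \<and> (\<forall>X\<in>V. \<forall>Y. real_ibracket f X Y \<in> V)"

definition simple_lie_algebra :: "('g::finite \<Rightarrow> 'g \<Rightarrow> 'g \<Rightarrow> real) \<Rightarrow> bool" where
  "simple_lie_algebra f \<longleftrightarrow>
     (\<forall>a b c. f a b c = - f b a c \<and> f a b c = - f a c b) \<and>
     (\<forall>X Y Z. real_ibracket f X (real_ibracket f Y Z) + real_ibracket f Y (real_ibracket f Z X)
              + real_ibracket f Z (real_ibracket f X Y) = 0) \<and>
     (\<exists>X Y. real_ibracket f X Y \<noteq> 0) \<and>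
     (\<forall>V. lie_ideal f V \<longrightarrow> V = {0} \<or> V = UNIV)"


section \<open>Expressions in fields and delta functions\<close>

text \<open>The points \<open>x\<close>, \<open>x'\<close>, \<open>x''\<close>.\<close>

datatype point = X0 | X1 | X2

text \<open>Field species; all Lorentz indices are upper ones.\<close>

datatype species = FF 4 4 | AA 4 | WW | JJ 4

text \<open>
  \<open>Fld S D phi a p\<close> is the colour component \<open>a\<close> of \<open>phi\<close> at \<open>p\<close>, with operators \<open>I^nu\<close> for \<open>nu \<in> S\<close>
  and derivatives \<open>\<partial>_nu\<close> for \<open>nu \<in> D\<close> applied.
  \<open>Ker p q S S' D\<close> is the delta function \<open>\<delta>(p - q)\<close>, string-integrated by \<open>I^nu\<close> (\<open>nu \<in> S\<close>) acting
  on \<open>p\<close> and by \<open>I^nu\<close> (\<open>nu \<in> S'\<close>) acting on \<open>q\<close>, and differentiated by \<open>\<partial>_nu\<close> (\<open>nu \<in> D\<close>) with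
  respect to its first argument \<open>p\<close>.
\<close>

datatype 'g factor =
    Fld "4 multiset" "4 multiset" species 'g point
  | Ker point point "4 multiset" "4 multiset" "4 multiset"

text \<open>
  Polynomials in the factors: a monomial is a multiset of factors. These are formal expressions,
  so that the parts with and without string-integrated delta functions are well defined; the identities
  between expressions are imposed separately below.
\<close>

type_synonym 'g expr = "'g factor multiset \<Rightarrow>\<^sub>0 complex"

definition cst :: "complex \<Rightarrow> 'g expr" where
  "cst k = Poly_Mapping.single {#} k"

definition atom :: "'g factor \<Rightarrow> 'g expr" where
  "atom v = Poly_Mapping.single {#v#} 1"

text \<open>The sum over all ways of replacing one factor \<open>v\<close> by \<open>g v\<close>.\<close>

definition repl :: "('g factor \<Rightarrow> 'g expr) \<Rightarrow> 'g expr \<Rightarrow> 'g expr" where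
  "repl g e = (\<Sum>m\<in>Poly_Mapping.keys e. \<Sum>v\<in>#m.
      Poly_Mapping.single (m - {#v#}) (Poly_Mapping.lookup e m) * g v)"

fun der_factor :: "point \<Rightarrow> 4 \<Rightarrow> 'g factor \<Rightarrow> 'g expr" where
  "der_factor p \<mu> (Fld S D \<phi> a q) = (if p = q then atom (Fld S (add_mset \<mu> D) \<phi> a q) else 0)"
| "der_factor p \<mu> (Ker q r S S' D) =
     (if p = q then atom (Ker q r S S' (add_mset \<mu> D)) else 0)
     - (if p = r then atom (Ker q r S S' (add_mset \<mu> D)) else 0)"

text \<open>The derivative \<open>\<partial>_mu\<close> with respect to the point \<open>p\<close>.\<close>

definition der :: "point \<Rightarrow> 4 \<Rightarrow> 'g expr \<Rightarrow> 'g expr" where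
  "der p \<mu> = repl (der_factor p \<mu>)"

fun relabel_factor :: "(point \<Rightarrow> point) \<Rightarrow> 'g factor \<Rightarrow> 'g factor" where
  "relabel_factor \<pi> (Fld S D \<phi> a p) = Fld S D \<phi> a (\<pi> p)"
| "relabel_factor \<pi> (Ker p q S S' D) = Ker (\<pi> p) (\<pi> q) S S' D"

definition relabel :: "(point \<Rightarrow> point) \<Rightarrow> 'g expr \<Rightarrow> 'g expr" where
  "relabel \<pi> e = (\<Sum>m\<in>Poly_Mapping.keys e.
      Poly_Mapping.single (image_mset (relabel_factor \<pi>) m) (Poly_Mapping.lookup e m))"

text \<open>The average over the six permutations of \<open>x\<close>, \<open>x'\<close>, \<open>x''\<close>.\<close>

definition sym3 :: "'g expr \<Rightarrow> 'g expr" where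
  "sym3 e = cst (1/6) * (\<Sum>\<pi> | bij \<pi>. relabel \<pi> e)"

fun string_integrated :: "'g factor \<Rightarrow> bool" where
  "string_integrated (Fld S D \<phi> a p) \<longleftrightarrow> False"
| "string_integrated (Ker p q S S' D) \<longleftrightarrow> S \<noteq> {#} \<or> S' \<noteq> {#}"

text \<open>The parts \<open>e|\<^sub>\<delta>\<close> and \<open>e|\<^sub>I\<^sub>\<delta>\<close>.\<close>

definition dpart :: "'g expr \<Rightarrow> 'g expr" where
  "dpart e = (\<Sum>m\<in>{m \<in> Poly_Mapping.keys e. \<forall>v\<in>#m. \<not> string_integrated v}.
      Poly_Mapping.single m (Poly_Mapping.lookup e m))"

definition spart :: "'g expr \<Rightarrow> 'g expr" where
  "spart e = e - dpart e"

text \<open>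
  Expressions \<open>U(x;x',x'')\<close>: every monomial contains (possibly string-integrated and differentiated)
  delta functions that connect the three points. Two edges on three vertices connect them as soon
  as they cover them.
\<close>

fun ends :: "'g factor \<Rightarrow> point set" where
  "ends (Fld S D \<phi> a p) = {}"
| "ends (Ker p q S S' D) = {p, q}"

definition three_point :: "'g expr \<Rightarrow> bool" where
  "three_point e \<longleftrightarrow> (\<forall>m\<in>Poly_Mapping.keys e.
      (\<forall>p S S' D. Ker p p S S' D \<notin># m) \<and>
      (\<exists>v\<in>#m. \<exists>v'\<in>#m. ends v \<union> ends v' = UNIV))"


section \<open>Fields\<close>

definition eta :: "4 \<Rightarrow> 4 \<Rightarrow> real" where
  "eta \<mu> \<nu> = (if \<mu> = \<nu> then (if \<mu> = 0 then 1 else -1) else 0)"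

definition kron :: "'i \<Rightarrow> 'i \<Rightarrow> real" where
  "kron i k = (if i = k then 1 else 0)"

text \<open>
  Lie algebra valued fields are families of colour components. \<open>S\<close> and \<open>D\<close> are as in \<open>Fld\<close>; the
  suffixes \<open>up\<close> and \<open>lo\<close> give the position of the Lorentz indices.
\<close>

definition F_up :: "4 multiset \<Rightarrow> 4 multiset \<Rightarrow> point \<Rightarrow> 4 \<Rightarrow> 4 \<Rightarrow> 'g \<Rightarrow> 'g expr" where
  "F_up S D p \<mu> \<nu> a = atom (Fld S D (FF \<mu> \<nu>) a p)"

definition F_lo :: "4 multiset \<Rightarrow> 4 multiset \<Rightarrow> point \<Rightarrow> 4 \<Rightarrow> 4 \<Rightarrow> 'g \<Rightarrow> 'g expr" where
  "F_lo S D p \<mu> \<nu> a = (\<Sum>\<rho>\<in>UNIV. \<Sum>\<sigma>\<in>UNIV. cst (eta \<mu> \<rho> * eta \<nu> \<sigma>) * F_up S D p \<rho> \<sigma> a)"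

definition A_up :: "4 multiset \<Rightarrow> 4 multiset \<Rightarrow> point \<Rightarrow> 4 \<Rightarrow> 'g \<Rightarrow> 'g expr" where
  "A_up S D p \<mu> a = atom (Fld S D (AA \<mu>) a p)"

definition A_lo :: "4 multiset \<Rightarrow> 4 multiset \<Rightarrow> point \<Rightarrow> 4 \<Rightarrow> 'g \<Rightarrow> 'g expr" where
  "A_lo S D p \<mu> a = (\<Sum>\<rho>\<in>UNIV. cst (eta \<mu> \<rho>) * A_up S D p \<rho> a)"

definition w_fld :: "4 multiset \<Rightarrow> 4 multiset \<Rightarrow> point \<Rightarrow> 'g \<Rightarrow> 'g expr" where
  "w_fld S D p a = atom (Fld S D WW a p)"

definition j_up :: "4 multiset \<Rightarrow> 4 multiset \<Rightarrow> point \<Rightarrow> 4 \<Rightarrow> 'g \<Rightarrow> 'g expr" where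
  "j_up S D p \<mu> a = atom (Fld S D (JJ \<mu>) a p)"

abbreviation "Fu \<equiv> F_up {#} {#}"
abbreviation "Au \<equiv> A_up {#} {#}"
abbreviation "Al \<equiv> A_lo {#} {#}"
abbreviation "w0 \<equiv> w_fld {#} {#}"
abbreviation "ju \<equiv> j_up {#} {#}"

definition delta :: "point \<Rightarrow> point \<Rightarrow> 'g expr" where
  "delta p q = atom (Ker p q {#} {#} {#})"

text \<open>\<open>I^S I'^S' \<partial>^lambda \<delta>(p - q)\<close> with a raised derivative index.\<close>

definition ker_dup :: "point \<Rightarrow> point \<Rightarrow> 4 multiset \<Rightarrow> 4 multiset \<Rightarrow> 4 \<Rightarrow> 'g expr" where
  "ker_dup p q S S' l = (\<Sum>\<rho>\<in>UNIV. cst (eta l \<rho>) * atom (Ker p q S S' {#\<rho>#}))"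

definition lbracket ::
  "('g::finite \<Rightarrow> 'g \<Rightarrow> 'g \<Rightarrow> real) \<Rightarrow> ('g \<Rightarrow> 'g expr) \<Rightarrow> ('g \<Rightarrow> 'g expr) \<Rightarrow> 'g \<Rightarrow> 'g expr" where
  "lbracket f X Y c = (\<Sum>a\<in>UNIV. \<Sum>b\<in>UNIV. cst (\<i> * f a b c) * X a * Y b)"

definition ibracket ::
  "('g::finite \<Rightarrow> 'g \<Rightarrow> 'g \<Rightarrow> real) \<Rightarrow> ('g \<Rightarrow> 'g expr) \<Rightarrow> ('g \<Rightarrow> 'g expr) \<Rightarrow> 'g \<Rightarrow> 'g expr" where
  "ibracket f X Y c = cst \<i> * lbracket f X Y c"

definition ip :: "('g::finite \<Rightarrow> 'g expr) \<Rightarrow> ('g \<Rightarrow> 'g expr) \<Rightarrow> 'g expr" where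
  "ip X Y = (\<Sum>a\<in>UNIV. X a * Y a)"


section \<open>Identities between expressions\<close>

text \<open>
  \<open>N\<close> is the set of expressions that vanish as field-valued distributions. It contains the field
  equations and the rules for delta functions and string integrations, but may be larger.
  Two expressions are equal if their difference lies in \<open>N\<close>.
\<close>

definition field_identities :: "'g expr set \<Rightarrow> bool" where
  "field_identities N \<longleftrightarrow> (\<forall>S D p a.
     (\<forall>\<mu> \<nu>. F_up S D p \<mu> \<nu> a + F_up S D p \<nu> \<mu> a \<in> N) \<and>
     (\<forall>\<nu>. (\<Sum>\<mu>\<in>UNIV. F_up S (add_mset \<mu> D) p \<mu> \<nu> a) \<in> N) \<and>
     (\<forall>\<mu> \<nu>. A_lo S (add_mset \<mu> D) p \<nu> a - A_lo S (add_mset \<nu> D) p \<mu> a - F_lo S D p \<mu> \<nu> a \<in> N) \<and>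
     (\<Sum>\<mu>\<in>UNIV. A_up S (add_mset \<mu> D) p \<mu> a) \<in> N \<and>
     (\<forall>\<mu>. A_lo S D p \<mu> a - (\<Sum>\<nu>\<in>UNIV. F_lo (add_mset \<nu> S) D p \<mu> \<nu> a) \<in> N) \<and>
     (\<Sum>\<mu>\<in>UNIV. j_up S (add_mset \<mu> D) p \<mu> a) \<in> N \<and>
     (\<forall>\<phi>. (\<Sum>\<nu>\<in>UNIV. atom (Fld (add_mset \<nu> S) (add_mset \<nu> D) \<phi> a p)) + atom (Fld S D \<phi> a p) \<in> N))"

text \<open>
  In turn: \<open>\<delta>(p - q)\<close> is symmetric, \<open>\<partial>_nu I^nu = -1\<close>, and \<open>g(p) \<delta>(p - q) = g(q) \<delta>(p - q)\<close>
  for fields and for kernels.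
\<close>

definition kernel_identities :: "'g expr set \<Rightarrow> bool" where
  "kernel_identities N \<longleftrightarrow> (\<forall>p q. p \<noteq> q \<longrightarrow>
     (\<forall>S S' D. atom (Ker p q S S' D) - cst ((-1) ^ size D) * atom (Ker q p S' S D) \<in> N) \<and>
     (\<forall>S S' D. (\<Sum>\<nu>\<in>UNIV. atom (Ker p q (add_mset \<nu> S) S' (add_mset \<nu> D)))
               + atom (Ker p q S S' D) \<in> N) \<and>
     (\<forall>S D \<phi> a. (atom (Fld S D \<phi> a p) - atom (Fld S D \<phi> a q)) * delta p q \<in> N) \<and>
     (\<forall>r S S' D. r \<noteq> p \<longrightarrow> r \<noteq> q \<longrightarrow>
        (atom (Ker p r S S' D) - atom (Ker q r S S' D)) * delta p q \<in> N))"

definition expression_identities :: "'g expr set \<Rightarrow> bool" where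
  "expression_identities N \<longleftrightarrow>
     0 \<in> N \<and> (\<forall>e\<in>N. \<forall>e'\<in>N. e + e' \<in> N) \<and> (\<forall>e\<in>N. \<forall>g. g * e \<in> N) \<and>
     (\<forall>e\<in>N. \<forall>p \<mu>. der p \<mu> e \<in> N) \<and> (\<forall>e\<in>N. \<forall>\<pi>. bij \<pi> \<longrightarrow> relabel \<pi> e \<in> N) \<and>
     field_identities N \<and> kernel_identities N"

definition string_variation :: "'g expr set \<Rightarrow> ('g expr \<Rightarrow> 'g expr) \<Rightarrow> bool" where
  "string_variation N dc \<longleftrightarrow>
     (\<forall>e e'. dc (e + e') = dc e + dc e') \<and> (\<forall>k e. dc (cst k * e) = cst k * dc e) \<and>
     (\<forall>e e'. dc (e * e') = dc e * e' + e * dc e') \<and>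
     (\<forall>p \<mu> a. dc (Al p \<mu> a) - der p \<mu> (w0 p a) \<in> N) \<and>
     (\<forall>p \<mu> \<nu> a. dc (Fu p \<mu> \<nu> a) \<in> N) \<and>
     (\<forall>p \<mu> a. dc (ju p \<mu> a) \<in> N)"


section \<open>Obstructions\<close>

text \<open>
  \<open>O2 p q mu phi a psi b\<close> stands for \<open>O_mu(phi_a(p), psi_b(q))\<close>; \<open>G\<close> is the colour-stripped
  gluonic part. The first Lorentz index of a contracted obstruction is summed with \<open>mu\<close>, and only
  these sums are prescribed. The prescriptions are equalities of formal expressions: the \<open>\<delta>\<close>-part of
  an expression is not invariant under \<open>\<partial>_nu I^nu = -1\<close>.
\<close>

type_synonym 'g obst2 = "point \<Rightarrow> point \<Rightarrow> 4 \<Rightarrow> species \<Rightarrow> 'g \<Rightarrow> species \<Rightarrow> 'g \<Rightarrow> 'g expr"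

definition gluonic :: "species \<Rightarrow> bool" where
  "gluonic \<phi> \<longleftrightarrow> (\<forall>\<mu>. \<phi> \<noteq> JJ \<mu>)"

definition G_A_lo ::
  "(point \<Rightarrow> point \<Rightarrow> 4 \<Rightarrow> species \<Rightarrow> species \<Rightarrow> 'g expr) \<Rightarrow> point \<Rightarrow> point \<Rightarrow> 4 \<Rightarrow> 4 \<Rightarrow> species \<Rightarrow> 'g expr" where
  "G_A_lo G p q \<mu> \<nu> \<psi> = (\<Sum>\<rho>\<in>UNIV. cst (eta \<nu> \<rho>) * G p q \<mu> (AA \<rho>) \<psi>)"

definition gluonic_kernels ::
  "real \<Rightarrow> (point \<Rightarrow> point \<Rightarrow> 4 \<Rightarrow> species \<Rightarrow> species \<Rightarrow> 'g expr) \<Rightarrow> bool" where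
  "gluonic_kernels cF G \<longleftrightarrow>
     (\<forall>p q. p \<noteq> q \<longrightarrow>
       (\<forall>\<nu> \<kappa> l. (\<Sum>\<mu>\<in>UNIV. G p q \<mu> (FF \<mu> \<nu>) (FF \<kappa> l)) =
          cst (- (1 + cF) * \<i>) *
            (cst (eta \<nu> \<kappa>) * ker_dup p q {#} {#} l - cst (eta \<nu> l) * ker_dup p q {#} {#} \<kappa>)) \<and>
       (\<forall>\<nu> \<kappa>. (\<Sum>\<mu>\<in>UNIV. G p q \<mu> (FF \<mu> \<nu>) (AA \<kappa>)) =
          cst (- \<i>) * (cst (eta \<nu> \<kappa>) * delta p q - ker_dup p q {#} {#\<nu>#} \<kappa>)) \<and>
       (\<forall>\<mu> \<nu> \<kappa> l. G_A_lo G p q \<mu> \<nu> (FF \<kappa> l) - G_A_lo G p q \<nu> \<mu> (FF \<kappa> l) =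
          cst (- cF * (kron \<mu> \<kappa> * kron \<nu> l - kron \<mu> l * kron \<nu> \<kappa>) * \<i>) * delta p q) \<and>
       (\<forall>\<mu> \<nu> \<kappa>. G_A_lo G p q \<mu> \<nu> (AA \<kappa>) - G_A_lo G p q \<nu> \<mu> (AA \<kappa>) = 0) \<and>
       (\<forall>\<kappa> l. (\<Sum>\<mu>\<in>UNIV. G p q \<mu> (AA \<mu>) (FF \<kappa> l)) =
          cst (- \<i>) * (ker_dup p q {#\<kappa>#} {#} l - ker_dup p q {#l#} {#} \<kappa>)) \<and>
       (\<forall>\<kappa>. (\<Sum>\<mu>\<in>UNIV. G p q \<mu> (AA \<mu>) (AA \<kappa>)) =
          cst (- \<i>) * (atom (Ker p q {#\<kappa>#} {#} {#})
             - (\<Sum>\<nu>\<in>UNIV. \<Sum>\<rho>\<in>UNIV. cst (eta \<nu> \<rho>) * ker_dup p q {#\<rho>#} {#\<nu>#} \<kappa>))) \<and>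
       (\<forall>\<mu> \<nu> \<kappa>. dpart (G_A_lo G p q \<mu> \<nu> (AA \<kappa>)) = 0)) \<and>
     (\<exists>k. \<forall>p q \<mu> \<nu> \<kappa> l. p \<noteq> q \<longrightarrow>
       dpart (G_A_lo G p q \<mu> \<nu> (FF \<kappa> l)) =
         cst (k * (kron \<mu> \<kappa> * kron \<nu> l - kron \<mu> l * kron \<nu> \<kappa>) * \<i>) * delta p q)"

definition two_point_obstructions ::
  "('g::finite \<Rightarrow> 'g \<Rightarrow> 'g \<Rightarrow> real) \<Rightarrow> real \<Rightarrow> 'g obst2 \<Rightarrow> bool" where
  "two_point_obstructions f cF O2 \<longleftrightarrow>
     (\<exists>G. gluonic_kernels cF G \<and>
        (\<forall>p q \<mu> \<phi> \<psi> a b. p \<noteq> q \<longrightarrow> gluonic \<phi> \<longrightarrow> gluonic \<psi> \<longrightarrow>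
            O2 p q \<mu> \<phi> a \<psi> b = cst (kron a b) * G p q \<mu> \<phi> \<psi>)) \<and>
     (\<forall>p q. p \<noteq> q \<longrightarrow>
        (\<forall>\<mu> a \<psi> b. O2 p q \<mu> WW a \<psi> b = 0) \<and>
        (\<forall>a b \<kappa>. (\<Sum>\<mu>\<in>UNIV. O2 p q \<mu> (JJ \<mu>) a (JJ \<kappa>) b) =
            - (\<Sum>c\<in>UNIV. cst (f a b c) * ju p \<kappa> c) * cst \<i> * delta p q) \<and>
        (\<forall>\<mu> \<phi> \<kappa> a b. gluonic \<phi> \<longrightarrow> O2 p q \<mu> \<phi> a (JJ \<kappa>) b = 0 \<and> O2 p q \<mu> (JJ \<kappa>) a \<phi> b = 0))"

fun plain_at :: "point \<Rightarrow> (species \<Rightarrow> 'g \<Rightarrow> 'g expr) \<Rightarrow> 'g factor \<Rightarrow> 'g expr" where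
  "plain_at p h (Fld S D \<phi> a q) = (if q = p \<and> S = {#} \<and> D = {#} then h \<phi> a else 0)"
| "plain_at p h (Ker q r S S' D) = 0"

text \<open>\<open>O_Y(X)\<close> for \<open>Y^mu\<close> at \<open>p\<close> and \<open>X\<close> at \<open>q\<close>.\<close>

definition obst :: "'g obst2 \<Rightarrow> point \<Rightarrow> point \<Rightarrow> (4 \<Rightarrow> 'g expr) \<Rightarrow> 'g expr \<Rightarrow> 'g expr" where
  "obst O2 p q Y X =
     (\<Sum>\<mu>\<in>UNIV. repl (plain_at p (\<lambda>\<phi> a. repl (plain_at q (\<lambda>\<psi> b. O2 p q \<mu> \<phi> a \<psi> b)) X)) (Y \<mu>))"

text \<open>
  The obstruction of \<open>Y \<cdot> \<delta>(x - x')\<close> with \<open>X\<close> at \<open>x''\<close>. The rule only fixes its symmetrization in \<open>x\<close>,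
  \<open>x'\<close>, and it only occurs symmetrized.
\<close>

definition obst_delta :: "'g obst2 \<Rightarrow> (4 \<Rightarrow> 'g expr) \<Rightarrow> 'g expr \<Rightarrow> 'g expr" where
  "obst_delta O2 Y X = cst (1/2) * obst O2 X0 X2 Y X * delta X0 X1"


section \<open>The QCD interaction\<close>

definition L1 :: "('g::finite \<Rightarrow> 'g \<Rightarrow> 'g \<Rightarrow> real) \<Rightarrow> point \<Rightarrow> 'g expr" where
  "L1 f p = cst (1/2) * (\<Sum>\<mu>\<in>UNIV. \<Sum>\<nu>\<in>UNIV. ip (Fu p \<mu> \<nu>) (ibracket f (Al p \<mu>) (Al p \<nu>)))
     + (\<Sum>\<mu>\<in>UNIV. ip (Al p \<mu>) (ju p \<mu>))"

definition Q1 :: "('g::finite \<Rightarrow> 'g \<Rightarrow> 'g \<Rightarrow> real) \<Rightarrow> point \<Rightarrow> 4 \<Rightarrow> 'g expr" where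
  "Q1 f p \<mu> = (\<Sum>\<nu>\<in>UNIV. ip (Fu p \<mu> \<nu>) (ibracket f (w0 p) (Al p \<nu>))) + ip (w0 p) (ju p \<mu>)"

definition L2 :: "('g::finite \<Rightarrow> 'g \<Rightarrow> 'g \<Rightarrow> real) \<Rightarrow> real \<Rightarrow> point \<Rightarrow> 'g expr" where
  "L2 f cF p = cst (- (1/2) * (1 + cF)) *
     (\<Sum>\<mu>\<in>UNIV. \<Sum>\<nu>\<in>UNIV. ip (ibracket f (Au p \<mu>) (Au p \<nu>)) (ibracket f (Al p \<mu>) (Al p \<nu>)))"

text \<open>The coefficient of \<open>\<delta>(x - x')\<close> in \<open>Q_2|\<^sub>\<delta>\<close>.\<close>

definition Q2_delta_coeff :: "('g::finite \<Rightarrow> 'g \<Rightarrow> 'g \<Rightarrow> real) \<Rightarrow> real \<Rightarrow> point \<Rightarrow> 4 \<Rightarrow> 'g expr" where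
  "Q2_delta_coeff f cF p \<mu> = cst (- 2 * (1 + cF)) *
     (\<Sum>\<nu>\<in>UNIV. ip (ibracket f (Au p \<mu>) (Au p \<nu>)) (ibracket f (w0 p) (Al p \<nu>)))"

definition w2 :: "('g::finite \<Rightarrow> 'g \<Rightarrow> 'g \<Rightarrow> real) \<Rightarrow> 'g \<Rightarrow> 'g expr" where
  "w2 f a = (\<Sum>\<nu>\<in>UNIV. ibracket f (w0 X1) (Al X1 \<nu>) a * atom (Ker X0 X1 {#\<nu>#} {#} {#}))"

definition dQ1_dw :: "('g::finite \<Rightarrow> 'g \<Rightarrow> 'g \<Rightarrow> real) \<Rightarrow> point \<Rightarrow> 4 \<Rightarrow> 'g \<Rightarrow> 'g expr" where
  "dQ1_dw f p \<mu> a = repl (\<lambda>v. if v = Fld {#} {#} WW a p then 1 else 0) (Q1 f p \<mu>)"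

text \<open>\<open>Q_2|\<^sub>I\<^sub>\<delta> = \<langle>dQ2_dw2 | w2\<rangle>\<close>.\<close>

definition dQ2_dw2 :: "('g::finite \<Rightarrow> 'g \<Rightarrow> 'g \<Rightarrow> real) \<Rightarrow> 4 \<Rightarrow> 'g \<Rightarrow> 'g expr" where
  "dQ2_dw2 f \<mu> a = cst 2 * dQ1_dw f X0 \<mu> a"


section \<open>Third order\<close>

definition O_Q1_L2 :: "('g::finite \<Rightarrow> 'g \<Rightarrow> 'g \<Rightarrow> real) \<Rightarrow> real \<Rightarrow> 'g obst2 \<Rightarrow> 'g expr" where
  "O_Q1_L2 f cF O2 = obst O2 X0 X1 (Q1 f X0) (L2 f cF X1)"

definition O_Q2d_L1 :: "('g::finite \<Rightarrow> 'g \<Rightarrow> 'g \<Rightarrow> real) \<Rightarrow> real \<Rightarrow> 'g obst2 \<Rightarrow> 'g expr" where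
  "O_Q2d_L1 f cF O2 = obst_delta O2 (Q2_delta_coeff f cF X0) (L1 f X2)"

text \<open>
  \<open>Ow2 mu a\<close> stands for \<open>O_mu(w_2(x,x')_a, L_1(x''))\<close>, which remains arbitrary.
\<close>

definition first_term ::
  "('g::finite \<Rightarrow> 'g \<Rightarrow> 'g \<Rightarrow> real) \<Rightarrow> (4 \<Rightarrow> 'g \<Rightarrow> 'g expr) \<Rightarrow> 'g expr" where
  "first_term f Ow2 = (\<Sum>\<mu>\<in>UNIV. ip (dQ2_dw2 f \<mu>) (Ow2 \<mu>))"

definition second_term :: "('g::finite \<Rightarrow> 'g \<Rightarrow> 'g \<Rightarrow> real) \<Rightarrow> 'g obst2 \<Rightarrow> 'g expr" where
  "second_term f O2 = ip (w2 f) (\<lambda>a. obst O2 X0 X2 (\<lambda>\<mu>. dQ2_dw2 f \<mu> a) (L1 f X2))"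

definition O_Q2_L1 ::
  "('g::finite \<Rightarrow> 'g \<Rightarrow> 'g \<Rightarrow> real) \<Rightarrow> real \<Rightarrow> 'g obst2 \<Rightarrow> (4 \<Rightarrow> 'g \<Rightarrow> 'g expr) \<Rightarrow> 'g expr" where
  "O_Q2_L1 f cF O2 Ow2 = O_Q2d_L1 f cF O2 + (first_term f Ow2 + second_term f O2)"

definition div_sym :: "(4 \<Rightarrow> 'g expr) \<Rightarrow> 'g expr" where
  "div_sym U = sym3 (\<Sum>\<mu>\<in>UNIV. der X0 \<mu> (U \<mu>))"

definition total_derivative :: "'g expr set \<Rightarrow> 'g expr \<Rightarrow> bool" where
  "total_derivative N e \<longleftrightarrow> (\<exists>U. (\<forall>\<mu>. three_point (U \<mu>)) \<and> e - div_sym U \<in> N)"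

text \<open>\<open>L3\<close> is at \<open>x\<close>.\<close>

definition third_order_condition ::
  "'g expr set \<Rightarrow> ('g expr \<Rightarrow> 'g expr) \<Rightarrow> ('g::finite \<Rightarrow> 'g \<Rightarrow> 'g \<Rightarrow> real) \<Rightarrow> real \<Rightarrow> 'g obst2 \<Rightarrow>
   (4 \<Rightarrow> 'g \<Rightarrow> 'g expr) \<Rightarrow> 'g expr \<Rightarrow> (4 \<Rightarrow> 'g expr) \<Rightarrow> bool" where
  "third_order_condition N dc f cF O2 Ow2 L3 Q3 \<longleftrightarrow>
     cst 3 * sym3 (O_Q1_L2 f cF O2 * delta X1 X2 + O_Q2_L1 f cF O2 Ow2)
     - (dc L3 * (delta X0 X1 * delta X1 X2) - div_sym Q3) \<in> N"

end

theory Submission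
  imports Defs
begin

text \<open>
  The \<open>\<delta>\<close>-part is a ring homomorphism that commutes with contractions, so only the \<open>\<delta>\<close>-parts of the
  two-point obstructions enter. In both contributions they put all fields at one point.
  With \<open>B = i[A,A]\<close> the first contribution becomes a multiple of
  \<open>\<langle>i[i[w,A\<^sub>\<mu>],A\<^sub>\<nu>]|B\<^sup>\<mu>\<^sup>\<nu>\<rangle>\<close>; antisymmetrizing in the Lorentz indices, the Jacobi identity turns it
  into \<open>\<langle>i[w,B]|B\<rangle>\<close>, which vanishes by invariance. The second contribution consists of one term of
  each of these two forms, whatever the free constant in the \<open>\<delta>\<close>-part of \<open>O\<^sub>\<mu>(A\<^sub>\<nu>,F')\<close>. Finally, by
  \<open>\<partial>\<^sub>\<nu> I\<^sup>\<nu> = -1\<close> every delta function is a sum of string-integrated ones, so the remaining total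
  derivatives can be written with \<open>Q\<^sub>3|\<^sub>\<delta> = 0\<close>.
\<close>

section \<open>Calculus of formal expressions\<close>

lemma expr_induct [case_names zero single add]:
  fixes e :: "'g expr"
  assumes "P 0" and "\<And>m c. P (Poly_Mapping.single m c)" and "\<And>a b. P a \<Longrightarrow> P b \<Longrightarrow> P (a + b)"
  shows "P e"
proof (induction e rule: Poly_Mapping.update_induct)
  case const
  show ?case by (fact assms(1))
next
  case (update e m c)
  \<comment> \<open>The induction supplies \<open>m\<close> outside the support of \<open>e\<close>,
    so the update changes no existing coefficient and is a sum.\<close>
  have "Poly_Mapping.update m c e = Poly_Mapping.single m c + e"
    using update.hyps
    by (intro poly_mapping_eqI)
      (auto simp: lookup_update lookup_add lookup_single when_def in_keys_iff)
  then show ?case using assms(2,3) update by simp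
qed

lemma cst_0 [simp]: "cst 0 = 0" by (simp add: cst_def)
lemma cst_1 [simp]: "cst 1 = 1"
  by (simp add: cst_def flip: zero_multiset_def)
lemma cst_add: "cst (a + b) = cst a + cst b" by (simp add: cst_def single_add)
lemma cst_diff: "cst (a - b) = cst a - cst b" by (simp add: cst_def single_diff)
lemma cst_uminus: "cst (- a) = - cst a" by (simp add: cst_def single_uminus)
lemma cst_mult: "cst (a * b) = cst a * cst b" by (simp add: cst_def mult_single)
lemma cst_sum: "cst (of_real (\<Sum>i\<in>S. h i)) = (\<Sum>i\<in>S. cst (of_real (h i)))"
  by (induction S rule: infinite_finite_induct) (simp_all add: cst_add)
lemma cst_numeral: "cst (numeral n) = numeral n"
  by (simp add: cst_def flip: zero_multiset_def)

section \<open>Replacing factors as a derivation\<close>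

lemma repl_add: "repl g (a + b) = repl g a + repl g b"
  unfolding repl_def
  by (rule setsum_keys_plus_distrib)
    (simp_all add: single_add distrib_right sum_mset.distrib)

lemma repl_0 [simp]: "repl g 0 = 0" by (simp add: repl_def)

lemma repl_single:
  "repl g (Poly_Mapping.single m c) = (\<Sum>v\<in>#m. Poly_Mapping.single (m - {#v#}) c * g v)"
  by (cases "c = 0") (simp_all add: repl_def)

lemma repl_cst [simp]: "repl g (cst k) = 0" by (simp add: cst_def repl_single)

lemma repl_atom [simp]: "repl g (atom v) = g v"
  by (simp add: atom_def repl_single flip: zero_multiset_def)

text \<open>A factor removed from the union of two monomials comes from one of them and leaves the
  other untouched; this is the Leibniz rule on monomials. With \<open>repl_atom\<close> and
  \<open>repl_cst\<close> it evaluates every replacement symbolically.\<close>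

lemma repl_mult: "repl g (a * b) = repl g a * b + a * repl g b"
proof (induction a rule: expr_induct)
  case (single m c)
  show ?case
  proof (induction b rule: expr_induct)
    case (single n d)
    have "(\<Sum>v\<in>#m. Poly_Mapping.single (m + n - {#v#}) (c * d) * g v)
        = (\<Sum>v\<in>#m. Poly_Mapping.single (m - {#v#}) c * g v) * Poly_Mapping.single n d"
      unfolding sum_mset_distrib_right
      by (intro arg_cong[where f = sum_mset] image_mset_cong)
        (auto dest!: multi_member_split simp: mult_single algebra_simps simp flip: mult.assoc)
    moreover have "(\<Sum>v\<in>#n. Poly_Mapping.single (m + n - {#v#}) (c * d) * g v)
        = Poly_Mapping.single m c * (\<Sum>v\<in>#n. Poly_Mapping.single (n - {#v#}) d * g v)"
      unfolding sum_mset_distrib_left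
      by (intro arg_cong[where f = sum_mset] image_mset_cong)
        (auto dest!: multi_member_split simp: mult_single simp flip: mult.assoc)
    ultimately show ?case by (simp add: mult_single repl_single)
  qed (simp_all add: repl_add distrib_left algebra_simps)
qed (simp_all add: repl_add algebra_simps)

lemma repl_sum: "repl g (sum h S) = (\<Sum>i\<in>S. repl g (h i))"
  by (induction S rule: infinite_finite_induct) (simp_all add: repl_add)

lemma sum_mset_sum_swap: "(\<Sum>v\<in>#M. \<Sum>i\<in>S. h i v) = (\<Sum>i\<in>S. \<Sum>v\<in>#M. h i v)"
  by (induction M) (simp_all add: sum.distrib)

lemma repl_sum_fun: "repl (\<lambda>v. \<Sum>i\<in>S. g i v) e = (\<Sum>i\<in>S. repl (g i) e)"
proof (induction e rule: expr_induct)
  case (single m c)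
  show ?case
    unfolding repl_single sum_distrib_left
    by (rule sum_mset_sum_swap)
qed (simp_all add: repl_add sum.distrib)

section \<open>The part without string-integrated kernels\<close>

lemma dpart_alt: "dpart e = (\<Sum>m\<in>Poly_Mapping.keys e.
    if \<forall>v\<in>#m. \<not> string_integrated v then Poly_Mapping.single m (Poly_Mapping.lookup e m) else 0)"
  unfolding dpart_def by (subst sum.inter_filter) simp_all

lemma dpart_add: "dpart (a + b) = dpart a + dpart b"
  unfolding dpart_alt by (rule setsum_keys_plus_distrib) (simp_all add: single_add)

lemma dpart_0 [simp]: "dpart 0 = 0" by (simp add: dpart_alt)

lemma dpart_single: "dpart (Poly_Mapping.single m c) =
    (if \<forall>v\<in>#m. \<not> string_integrated v then Poly_Mapping.single m c else 0)"
  unfolding dpart_alt keys_single by (simp split: if_splits)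

text \<open>A product of monomials is free of string-integrated kernels exactly when both are. Thus
  \<open>dpart\<close> is the substitution of zero for all such kernels.\<close>

lemma dpart_mult: "dpart (a * b) = dpart a * dpart b"
proof (induction a rule: expr_induct)
  case (single m c)
  show ?case
  proof (induction b rule: expr_induct)
    case (single n d)
    show ?case by (auto simp: mult_single dpart_single)
  qed (simp_all add: dpart_add distrib_left)
qed (simp_all add: dpart_add distrib_right)

lemma dpart_sum: "dpart (sum h S) = (\<Sum>i\<in>S. dpart (h i))"
  by (induction S rule: infinite_finite_induct) (simp_all add: dpart_add)

lemma dpart_sum_mset: "dpart (\<Sum>v\<in>#m. h v) = (\<Sum>v\<in>#m. dpart (h v))"
  by (induction m) (simp_all add: dpart_add)

lemma dpart_cst [simp]: "dpart (cst k) = cst k" by (simp add: cst_def dpart_single)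

lemma dpart_atom: "dpart (atom v) = (if string_integrated v then 0 else atom v)"
  by (simp add: atom_def dpart_single)

lemma dpart_uminus: "dpart (- a) = - dpart a"
  using dpart_add[of a "- a"] by (simp add: minus_unique)

lemma dpart_diff: "dpart (a - b) = dpart a - dpart b"
  using dpart_add[of a "- b"] by (simp add: dpart_uminus)

lemma dpart_plain_at: "dpart (plain_at p h v) = plain_at p (\<lambda>\<phi> a. dpart (h \<phi> a)) v"
  by (cases v) auto

lemma plain_at_string: "string_integrated v \<Longrightarrow> plain_at p h v = 0"
  by (cases v) auto

text \<open>A contraction replaces fields only. A string-integrated kernel in a monomial survives
  every replacement, so such a monomial contributes nothing to the \<delta>-part.\<close>

lemma dpart_repl_plain_at:
  "dpart (repl (plain_at p h) e) = repl (plain_at p (\<lambda>\<phi> a. dpart (h \<phi> a))) (dpart e)"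
proof (induction e rule: expr_induct)
  case (single m c)
  let ?g = "plain_at p (\<lambda>\<phi> a. dpart (h \<phi> a))"
  have split: "dpart (repl (plain_at p h) (Poly_Mapping.single m c))
      = (\<Sum>v\<in>#m. dpart (Poly_Mapping.single (m - {#v#}) c) * ?g v)"
    by (simp add: repl_single dpart_sum_mset dpart_mult dpart_plain_at)
  show ?case
  proof (cases "\<forall>v\<in>#m. \<not> string_integrated v")
    case True
    then have "dpart (Poly_Mapping.single (m - {#v#}) c) = Poly_Mapping.single (m - {#v#}) c" for v
      by (auto simp: dpart_single dest: in_diffD)
    with True show ?thesis unfolding split by (simp add: dpart_single repl_single)
  next
    case False
    then obtain u where u: "u \<in># m" "string_integrated u" by blast
    \<comment> \<open>Either \<open>u\<close> stays in the monomial beside the replaced factor, or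
      \<open>u\<close> is itself the factor to be replaced, where \<open>plain_at\<close> gives
      zero.\<close>
    have "dpart (Poly_Mapping.single (m - {#v#}) c) * ?g v = 0" if "v \<in># m" for v
    proof (cases "v = u")
      case True
      with u show ?thesis by (simp add: plain_at_string)
    next
      case False
      then have "u \<in># m - {#v#}" using u by (simp add: in_diff_count)
      then show ?thesis using u by (auto simp: dpart_single)
    qed
    then have "(\<Sum>v\<in>#m. dpart (Poly_Mapping.single (m - {#v#}) c) * ?g v) = (\<Sum>v\<in>#m. 0)"
      by (intro arg_cong[where f = sum_mset] image_mset_cong) simp
    then show ?thesis using False by (auto simp: split dpart_single)
  qed
qed (simp_all add: repl_add dpart_add)

text \<open>Two applications of \<open>dpart_repl_plain_at\<close>: one for the contraction at
  \<open>p\<close>, one for the nested contraction at \<open>q\<close>.\<close>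

lemma dpart_obst: "dpart (obst O2 p q Y X) =
    obst (\<lambda>p q \<mu> \<phi> a \<psi> b. dpart (O2 p q \<mu> \<phi> a \<psi> b)) p q (\<lambda>\<mu>. dpart (Y \<mu>)) (dpart X)"
  unfolding obst_def by (simp add: dpart_sum dpart_repl_plain_at)

lemma plain_at_sum: "plain_at p (\<lambda>\<phi> a. \<Sum>i\<in>S. h i \<phi> a) v = (\<Sum>i\<in>S. plain_at p (h i) v)"
  by (cases v) auto

text \<open>The obstructions of F with A are prescribed only after summation over the derivative
  index. This pulls that sum inside the replacement, where the prescription applies.\<close>

lemma repl_plain_at_sum:
  "repl (plain_at p (\<lambda>\<phi> a. \<Sum>i\<in>S. h i \<phi> a)) e = (\<Sum>i\<in>S. repl (plain_at p (h i)) e)"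
  unfolding plain_at_sum repl_sum_fun ..

section \<open>Relabelling of points, symmetrization and divergences\<close>

lemma relabel_add: "relabel \<pi> (a + b) = relabel \<pi> a + relabel \<pi> b"
  unfolding relabel_def by (rule setsum_keys_plus_distrib) (simp_all add: single_add)

lemma relabel_0 [simp]: "relabel \<pi> 0 = 0" by (simp add: relabel_def)

lemma relabel_single: "relabel \<pi> (Poly_Mapping.single m c) =
    Poly_Mapping.single (image_mset (relabel_factor \<pi>) m) c"
  by (cases "c = 0") (simp_all add: relabel_def)

lemma relabel_mult_cst: "relabel \<pi> (cst k * e) = cst k * relabel \<pi> e"
  by (induction e rule: expr_induct)
    (simp_all add: relabel_add relabel_single cst_def mult_single distrib_left)

lemma sym3_add: "sym3 (a + b) = sym3 a + sym3 b"
  by (simp add: sym3_def relabel_add sum.distrib distrib_left)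

lemma sym3_mult_cst: "sym3 (cst k * e) = cst k * sym3 e"
  by (simp add: sym3_def relabel_mult_cst sum_distrib_left mult.left_commute)

lemma der_add: "der p \<mu> (a + b) = der p \<mu> a + der p \<mu> b"
  by (simp add: der_def repl_add)

lemma der_mult_cst: "der p \<mu> (cst k * e) = cst k * der p \<mu> e"
  by (simp add: der_def repl_mult)

lemma div_sym_add: "div_sym (\<lambda>\<mu>. U \<mu> + V \<mu>) = div_sym U + div_sym V"
  by (simp add: div_sym_def der_add sum.distrib sym3_add)

lemma div_sym_mult_cst: "div_sym (\<lambda>\<mu>. cst k * U \<mu>) = cst k * div_sym U"
  by (simp add: div_sym_def der_mult_cst sym3_mult_cst flip: sum_distrib_left)

section \<open>Lie algebra valued expressions\<close>

text \<open>The two factors \<i> combine to -1, which gives the formula of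
  \<open>real_ibracket\<close> with expressions as components.\<close>

lemma ibracket_eq:
  "ibracket f X Y c = - (\<Sum>a\<in>UNIV. \<Sum>b\<in>UNIV. cst (f a b c) * X a * Y b)"
proof -
  have i: "cst \<i> * cst (\<i> * f a b c) = - cst (f a b c)" for a b
    by (simp add: cst_uminus flip: cst_mult)
  have "cst \<i> * (cst (\<i> * f a b c) * X a * Y b) = - (cst (f a b c) * X a * Y b)" for a b
    unfolding mult.assoc[symmetric] i by simp
  then show ?thesis
    unfolding ibracket_def lbracket_def by (simp add: sum_distrib_left sum_negf)
qed

lemma repl_ip: "repl g (ip X Y) = ip (\<lambda>a. repl g (X a)) Y + ip X (\<lambda>a. repl g (Y a))"
  by (simp add: ip_def repl_sum repl_mult sum.distrib)

lemma repl_ibracket: "repl g (ibracket f X Y c) =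
    ibracket f (\<lambda>a. repl g (X a)) Y c + ibracket f X (\<lambda>a. repl g (Y a)) c"
  by (simp add: ibracket_def lbracket_def repl_sum repl_mult sum.distrib algebra_simps
      sum_distrib_left)

lemma dpart_ip: "dpart (ip X Y) = ip (\<lambda>a. dpart (X a)) (\<lambda>a. dpart (Y a))"
  by (simp add: ip_def dpart_sum dpart_mult)

lemma dpart_ibracket:
  "dpart (ibracket f X Y c) = ibracket f (\<lambda>a. dpart (X a)) (\<lambda>a. dpart (Y a)) c"
  by (simp add: ibracket_def lbracket_def dpart_sum dpart_mult)

lemma ip_commute: "ip X Y = ip Y X"
  by (simp add: ip_def mult.commute)

lemma ip_add_left: "ip (\<lambda>a. X a + X' a) Y = ip X Y + ip X' Y"
  by (simp add: ip_def distrib_right sum.distrib)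

lemma ip_add_right: "ip X (\<lambda>a. Y a + Y' a) = ip X Y + ip X Y'"
  by (simp add: ip_def distrib_left sum.distrib)

lemma ip_diff_left: "ip (\<lambda>a. X a - X' a) Y = ip X Y - ip X' Y"
  by (simp add: ip_def left_diff_distrib sum_subtractf)

lemma ip_uminus_left: "ip (\<lambda>a. - X a) Y = - ip X Y"
  by (simp add: ip_def sum_negf)

lemma ip_uminus_right: "ip X (\<lambda>a. - Y a) = - ip X Y"
  by (simp add: ip_def sum_negf)

lemma ip_mult_left: "ip (\<lambda>a. k * X a) Y = k * ip X Y"
  by (simp add: ip_def sum_distrib_left mult.assoc)

lemma ip_mult_right: "ip X (\<lambda>a. k * Y a) = k * ip X Y"
  by (simp add: ip_def sum_distrib_left mult.left_commute)

lemma ip_sum_left: "ip (\<lambda>a. \<Sum>i\<in>S. X i a) Y = (\<Sum>i\<in>S. ip (X i) Y)"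
  unfolding ip_def sum_distrib_right by (rule sum.swap)

lemma ip_zero_left [simp]: "ip (\<lambda>a. 0) Y = 0"
  by (simp add: ip_def)

lemma ip_zero_right [simp]: "ip X (\<lambda>a. 0) = 0"
  by (simp add: ip_def)

lemma ibracket_mult_left: "ibracket f (\<lambda>a. k * X a) Y = (\<lambda>c. k * ibracket f X Y c)"
  by (rule ext) (simp add: ibracket_def lbracket_def sum_distrib_left mult_ac)

lemma ibracket_mult_right: "ibracket f X (\<lambda>a. k * Y a) = (\<lambda>c. k * ibracket f X Y c)"
  by (rule ext) (simp add: ibracket_def lbracket_def sum_distrib_left mult_ac)

lemma ibracket_uminus_right: "ibracket f X (\<lambda>a. - Y a) = (\<lambda>c. - ibracket f X Y c)"
  using ibracket_mult_right[of f X "- 1" Y] by simp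

lemma ibracket_zero_left [simp]: "ibracket f (\<lambda>a. 0) Y = (\<lambda>c. 0)"
  by (rule ext) (simp add: ibracket_def lbracket_def)

lemma ibracket_zero_right [simp]: "ibracket f X (\<lambda>a. 0) = (\<lambda>c. 0)"
  by (rule ext) (simp add: ibracket_def lbracket_def)

section \<open>Antisymmetry, invariance and the Jacobi identity for formal brackets\<close>

lemma simple_lie_algebra_antisym:
  assumes "simple_lie_algebra f"
  shows "f a b c = - f b a c" and "f a b c = - f a c b"
  using assms unfolding simple_lie_algebra_def by blast+

lemma ibracket_antisym:
  assumes "simple_lie_algebra f"
  shows "ibracket f X Y c = - ibracket f Y X c"
proof -
  have "(\<Sum>a\<in>UNIV. \<Sum>b\<in>UNIV. cst (f a b c) * X a * Y b)
      = (\<Sum>b\<in>UNIV. \<Sum>a\<in>UNIV. - (cst (f b a c) * Y b * X a))"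
    by (subst sum.swap, intro sum.cong refl, subst simple_lie_algebra_antisym(1)[OF assms])
      (simp add: cst_uminus)
  then show ?thesis by (simp add: ibracket_eq sum_negf)
qed

text \<open>The coefficients are complex numbers. This takes the place of division by 2 in the
  antisymmetry arguments.\<close>

lemma expr_eq_uminus:
  fixes e :: "'g expr"
  assumes "e = - e"
  shows "e = 0"
proof (rule poly_mapping_eqI)
  fix m
  have "Poly_Mapping.lookup e m = - Poly_Mapping.lookup e m"
    using assms by (metis lookup_uminus)
  then show "Poly_Mapping.lookup e m = Poly_Mapping.lookup 0 m" by simp
qed

lemma ibracket_self:
  assumes "simple_lie_algebra f"
  shows "ibracket f X X c = 0"
  using expr_eq_uminus[OF ibracket_antisym[OF assms, of X X c]] .

text \<open>Invariance of the inner product: total antisymmetry makes \<open>f a b c\<close> cyclic,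
  so the bracket can be moved across the pairing.\<close>

lemma ip_ibracket:
  assumes "simple_lie_algebra f"
  shows "ip (ibracket f X Y) Z = ip X (ibracket f Y Z)"
proof -
  have f: "f a b c = f b c a" for a b c
    using simple_lie_algebra_antisym[OF assms] by (metis minus_minus)
  have "(\<Sum>c\<in>UNIV. \<Sum>a\<in>UNIV. \<Sum>b\<in>UNIV. cst (f a b c) * X a * Y b * Z c)
      = (\<Sum>a\<in>UNIV. \<Sum>b\<in>UNIV. \<Sum>c\<in>UNIV. cst (f a b c) * X a * Y b * Z c)"
    by (rule trans, rule sum.swap, rule sum.cong[OF refl], rule sum.swap)
  also have "\<dots> = (\<Sum>a\<in>UNIV. \<Sum>b\<in>UNIV. \<Sum>c\<in>UNIV. X a * (cst (f b c a) * Y b * Z c))"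
    by (intro sum.cong refl) (simp add: f[symmetric] mult_ac)
  finally show ?thesis
    by (simp add: ip_def ibracket_eq sum_distrib_left sum_distrib_right sum_negf)
qed

text \<open>The hypothesis gives the Jacobi identity for real vectors only. One component of it at
  three standard basis vectors is an identity between numbers, which can be carried over to formal
  expressions.\<close>

lemma structure_constants_jacobi:
  assumes "simple_lie_algebra f"
  shows "(\<Sum>e\<in>UNIV. f a e d * f b c e + f b e d * f c a e + f c e d * f a b e) = 0"
proof -
  have ax: "(\<Sum>i\<in>UNIV. (\<Sum>j\<in>UNIV. f i j k * (axis a 1 :: real^'a) $ i * Z $ j)) = (\<Sum>j\<in>UNIV. f a j k * Z $ j)"
    for a k Z
    by (simp add: axis_def if_distrib sum.delta' cong: if_cong flip: sum_distrib_right)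
       (subst sum.swap, simp add: sum.delta if_distrib if_distribR cong: if_cong)
  have br: "real_ibracket f (axis a 1) Z = (\<chi> k. - (\<Sum>j\<in>UNIV. f a j k * Z $ j))" for a Z
    by (simp add: real_ibracket_def ax)
  have br2: "real_ibracket f (axis a 1) (axis b 1) = (\<chi> k. - f a b k)" for a b
    unfolding br by (simp add: axis_def if_distrib cong: if_cong)
  have "real_ibracket f (axis a 1) (real_ibracket f (axis b 1) (axis c 1))
      + real_ibracket f (axis b 1) (real_ibracket f (axis c 1) (axis a 1))
      + real_ibracket f (axis c 1) (real_ibracket f (axis a 1) (axis b 1)) = 0"
    using assms unfolding simple_lie_algebra_def by blast
  then have "(real_ibracket f (axis a 1) (real_ibracket f (axis b 1) (axis c 1))
      + real_ibracket f (axis b 1) (real_ibracket f (axis c 1) (axis a 1))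
      + real_ibracket f (axis c 1) (real_ibracket f (axis a 1) (axis b 1))) $ d = 0"
    by simp
  then show ?thesis
    unfolding br2 unfolding br by (simp add: sum_negf sum.distrib)
qed

lemma ibracket_nested:
  "ibracket f X (ibracket f Y Z) d =
    (\<Sum>a\<in>UNIV. \<Sum>b\<in>UNIV. \<Sum>c\<in>UNIV. cst (\<Sum>e\<in>UNIV. f a e d * f b c e) * X a * Y b * Z c)"
proof -
  have "(\<Sum>e\<in>UNIV. cst (f a e d) * X a * (\<Sum>b\<in>UNIV. \<Sum>c\<in>UNIV. cst (f b c e) * Y b * Z c))
      = (\<Sum>b\<in>UNIV. \<Sum>c\<in>UNIV. cst (\<Sum>e\<in>UNIV. f a e d * f b c e) * X a * Y b * Z c)" for a
  proof -
    have "(\<Sum>e\<in>UNIV. cst (f a e d) * X a * (\<Sum>b\<in>UNIV. \<Sum>c\<in>UNIV. cst (f b c e) * Y b * Z c))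
        = (\<Sum>e\<in>UNIV. \<Sum>b\<in>UNIV. \<Sum>c\<in>UNIV. cst (f a e d * f b c e) * X a * Y b * Z c)"
      by (simp add: sum_distrib_left cst_mult mult_ac)
    also have "\<dots> = (\<Sum>b\<in>UNIV. \<Sum>e\<in>UNIV. \<Sum>c\<in>UNIV. cst (f a e d * f b c e) * X a * Y b * Z c)"
      by (rule sum.swap)
    also have "\<dots> = (\<Sum>b\<in>UNIV. \<Sum>c\<in>UNIV. \<Sum>e\<in>UNIV. cst (f a e d * f b c e) * X a * Y b * Z c)"
      by (rule sum.cong[OF refl], rule sum.swap)
    finally show ?thesis
      by (simp add: cst_sum sum_distrib_right del: of_real_sum of_real_mult)
  qed
  then show ?thesis by (simp add: ibracket_eq sum_negf)
qed

text \<open>Expressions commute, so after reordering the sums all three double brackets run over the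
  same products \<open>X a * Y b * Z c\<close>, and their coefficients add up to zero by
  \<open>structure_constants_jacobi\<close>.\<close>

lemma ibracket_jacobi:
  assumes "simple_lie_algebra f"
  shows "ibracket f X (ibracket f Y Z) d + ibracket f Y (ibracket f Z X) d
    + ibracket f Z (ibracket f X Y) d = 0"
proof -
  let ?J = "\<lambda>a b c. \<Sum>e\<in>UNIV. f a e d * f b c e"
  have 2: "ibracket f Y (ibracket f Z X) d =
      (\<Sum>a\<in>UNIV. \<Sum>b\<in>UNIV. \<Sum>c\<in>UNIV. cst (?J b c a) * X a * Y b * Z c)"
  proof -
    have "ibracket f Y (ibracket f Z X) d =
        (\<Sum>b\<in>UNIV. \<Sum>a\<in>UNIV. \<Sum>c\<in>UNIV. cst (?J b c a) * Y b * Z c * X a)"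
      unfolding ibracket_nested by (rule sum.cong[OF refl], rule sum.swap)
    also have "\<dots> = (\<Sum>a\<in>UNIV. \<Sum>b\<in>UNIV. \<Sum>c\<in>UNIV. cst (?J b c a) * Y b * Z c * X a)"
      by (rule sum.swap)
    finally show ?thesis by (simp add: mult_ac)
  qed
  have 3: "ibracket f Z (ibracket f X Y) d =
      (\<Sum>a\<in>UNIV. \<Sum>b\<in>UNIV. \<Sum>c\<in>UNIV. cst (?J c a b) * X a * Y b * Z c)"
  proof -
    have "ibracket f Z (ibracket f X Y) d =
        (\<Sum>a\<in>UNIV. \<Sum>c\<in>UNIV. \<Sum>b\<in>UNIV. cst (?J c a b) * Z c * X a * Y b)"
      unfolding ibracket_nested by (rule sum.swap)
    also have "\<dots> = (\<Sum>a\<in>UNIV. \<Sum>b\<in>UNIV. \<Sum>c\<in>UNIV. cst (?J c a b) * Z c * X a * Y b)"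
      by (rule sum.cong[OF refl], rule sum.swap)
    finally show ?thesis by (simp add: mult_ac)
  qed
  have J: "cst (?J a b c) + cst (?J b c a) + cst (?J c a b) = 0" for a b c
  proof -
    have "?J a b c + ?J b c a + ?J c a b = 0"
      using structure_constants_jacobi[OF assms, of a d b c] by (simp add: sum.distrib)
    then show ?thesis
      by (simp del: of_real_sum flip: cst_add of_real_add)
  qed
  have "ibracket f X (ibracket f Y Z) d + ibracket f Y (ibracket f Z X) d + ibracket f Z (ibracket f X Y) d
      = (\<Sum>a\<in>UNIV. \<Sum>b\<in>UNIV. \<Sum>c\<in>UNIV.
          (cst (?J a b c) + cst (?J b c a) + cst (?J c a b)) * X a * Y b * Z c)"
    unfolding 2 3 ibracket_nested[of f X Y Z] by (simp add: sum.distrib distrib_right)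
  also have "\<dots> = 0" by (simp only: J mult_zero_left sum.neutral_const)
  finally show ?thesis .
qed

lemma ip_ibracket_same:
  assumes "simple_lie_algebra f"
  shows "ip (ibracket f X Y) Y = 0"
  unfolding ip_ibracket[OF assms] by (simp add: ip_def ibracket_self[OF assms])

text \<open>With B = i[X,Y], the Jacobi identity turns i[i[W,X],Y] - i[i[W,Y],X] into i[W,B], whose
  pairing with B vanishes. The sign comes from i[Y,X] = -B and gives the form that
  \<open>sum_antisym_zero\<close> requires.\<close>

lemma ip_double_bracket_antisym:
  assumes "simple_lie_algebra f"
  shows "ip (ibracket f (ibracket f W X) Y) (ibracket f X Y)
    = - ip (ibracket f (ibracket f W Y) X) (ibracket f Y X)"
proof -
  let ?B = "ibracket f X Y"
  have B: "ibracket f Y X = (\<lambda>c. - ?B c)"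
    using ibracket_antisym[OF assms] by blast
  have J: "ibracket f (ibracket f W X) Y c - ibracket f (ibracket f W Y) X c = ibracket f W ?B c" for c
  proof -
    have "ibracket f (ibracket f W X) Y c = - ibracket f Y (ibracket f W X) c"
      by (rule ibracket_antisym[OF assms])
    moreover have "ibracket f (ibracket f W Y) X c = ibracket f X (\<lambda>a. - ibracket f W Y a) c"
      unfolding ibracket_antisym[OF assms, of "ibracket f W Y"] ibracket_uminus_right ..
    moreover have "(\<lambda>a. - ibracket f W Y a) = ibracket f Y W"
      by (rule ext) (simp add: ibracket_antisym[OF assms, of Y W])
    ultimately show ?thesis
      using ibracket_jacobi[OF assms, of W X Y c]
      by (simp add: neg_eq_iff_add_eq_0 algebra_simps)
  qed
  have "ip (ibracket f (ibracket f W X) Y) ?B - ip (ibracket f (ibracket f W Y) X) ?B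
      = ip (ibracket f W ?B) ?B"
    unfolding ip_diff_left[symmetric] by (simp add: J)
  also have "\<dots> = 0" by (rule ip_ibracket_same[OF assms])
  finally show ?thesis unfolding B ip_uminus_right by simp
qed

section \<open>The parts without string integrations\<close>

text \<open>The metric is diagonal, so lowering an index is multiplication by a sign, without a
  sum.\<close>

lemma A_lo_eq: "A_lo S D p \<mu> = (\<lambda>a. cst (eta \<mu> \<mu>) * A_up S D p \<mu> a)"
proof (rule ext)
  fix a
  have "A_lo S D p \<mu> a = (\<Sum>\<rho>\<in>UNIV. if \<rho> = \<mu> then cst (eta \<mu> \<mu>) * A_up S D p \<mu> a else 0)"
    unfolding A_lo_def by (rule sum.cong) (auto simp: eta_def)
  then show "A_lo S D p \<mu> a = cst (eta \<mu> \<mu>) * A_up S D p \<mu> a" by simp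
qed

lemma G_A_lo_eq: "G_A_lo G p q \<mu> \<nu> \<psi> = cst (eta \<nu> \<nu>) * G p q \<mu> (AA \<nu>) \<psi>"
proof -
  have "G_A_lo G p q \<mu> \<nu> \<psi> = (\<Sum>\<rho>\<in>UNIV. if \<rho> = \<nu> then cst (eta \<nu> \<nu>) * G p q \<mu> (AA \<nu>) \<psi> else 0)"
    unfolding G_A_lo_def by (rule sum.cong) (auto simp: eta_def)
  then show ?thesis by simp
qed

lemma cst_eta_square: "cst (eta \<mu> \<mu>) * cst (eta \<mu> \<mu>) = 1"
  by (auto simp: eta_def simp flip: cst_mult)

lemma cst_eta_square_left: "cst (eta \<mu> \<mu>) * (cst (eta \<mu> \<mu>) * e) = e"
  unfolding mult.assoc[symmetric] cst_eta_square by simp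

lemma repl_plain_at_fields [simp]:
  "repl (plain_at p h) (F_up {#} {#} p \<mu> \<nu> a) = h (FF \<mu> \<nu>) a"
  "repl (plain_at p h) (A_up {#} {#} p \<mu> a) = h (AA \<mu>) a"
  "repl (plain_at p h) (A_lo {#} {#} p \<mu> a) = cst (eta \<mu> \<mu>) * h (AA \<mu>) a"
  "repl (plain_at p h) (w_fld {#} {#} p a) = h WW a"
  "repl (plain_at p h) (j_up {#} {#} p \<mu> a) = h (JJ \<mu>) a"
  by (simp_all add: F_up_def A_up_def A_lo_eq w_fld_def j_up_def repl_mult)

lemma dpart_fields [simp]:
  "dpart (F_up S D p \<mu> \<nu> a) = F_up S D p \<mu> \<nu> a"
  "dpart (A_up S D p \<mu> a) = A_up S D p \<mu> a"
  "dpart (A_lo S D p \<mu> a) = A_lo S D p \<mu> a"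
  "dpart (w_fld S D p a) = w_fld S D p a"
  "dpart (j_up S D p \<mu> a) = j_up S D p \<mu> a"
  by (simp_all add: F_up_def A_up_def A_lo_eq w_fld_def j_up_def dpart_mult dpart_atom)

lemma dpart_delta [simp]: "dpart (delta p q) = delta p q"
  by (simp add: delta_def dpart_atom)

text \<open>These are polynomials in fields alone and contain no kernels.\<close>

lemma dpart_interaction:
  "dpart (L1 f p) = L1 f p"
  "dpart (Q1 f p \<mu>) = Q1 f p \<mu>"
  "dpart (L2 f cF p) = L2 f cF p"
  "dpart (Q2_delta_coeff f cF p \<mu>) = Q2_delta_coeff f cF p \<mu>"
  by (simp_all add: L1_def Q1_def L2_def Q2_delta_coeff_def dpart_add dpart_mult dpart_sum
      dpart_ip dpart_ibracket)

lemma dpart_ker_dup: "dpart (ker_dup p q S S' l) = (if S = {#} \<and> S' = {#} then ker_dup p q S S' l else 0)"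
  by (auto simp: ker_dup_def dpart_sum dpart_mult dpart_atom)

text \<open>The contraction table with every string-integrated kernel dropped. Covariance fixes the
  contraction of A with F up to a factor; \<open>k\<close> stays undetermined but is the same for
  all points and indices.\<close>

lemma dpart_contractions:
  assumes "two_point_obstructions f cF O2"
  shows "p \<noteq> q \<Longrightarrow> (\<Sum>\<mu>\<in>UNIV. dpart (O2 p q \<mu> (FF \<mu> \<nu>) a (AA \<kappa>) b)) =
      cst (kron a b) * (cst (- \<i>) * (cst (eta \<nu> \<kappa>) * delta p q))"
    and "p \<noteq> q \<Longrightarrow> dpart (O2 p q \<mu> (AA \<nu>) a (AA \<kappa>) b) = 0"
    and "\<exists>k. \<forall>p q \<mu> \<nu> \<kappa> l a b. p \<noteq> q \<longrightarrow> dpart (O2 p q \<mu> (AA \<nu>) a (FF \<kappa> l) b) =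
      cst (kron a b) * (cst (eta \<nu> \<nu>) * (cst (k * (kron \<mu> \<kappa> * kron \<nu> l - kron \<mu> l * kron \<nu> \<kappa>) * \<i>) * delta p q))"
    and "p \<noteq> q \<Longrightarrow> O2 p q \<mu> WW a \<psi> b = 0"
    and "p \<noteq> q \<Longrightarrow> O2 p q \<mu> (AA \<nu>) a (JJ \<kappa>) b = 0"
    and "p \<noteq> q \<Longrightarrow> O2 p q \<mu> (JJ \<kappa>) a (AA \<nu>) b = 0"
proof -
  note O2_parts = assms[unfolded two_point_obstructions_def]
  from O2_parts[THEN conjunct1] obtain G where G: "gluonic_kernels cF G"
    and O2: "\<forall>p q \<mu> \<phi> \<psi> a b. p \<noteq> q \<longrightarrow> gluonic \<phi> \<longrightarrow> gluonic \<psi> \<longrightarrow>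
      O2 p q \<mu> \<phi> a \<psi> b = cst (kron a b) * G p q \<mu> \<phi> \<psi>"
    by (elim exE conjE)
  note G_parts = G[unfolded gluonic_kernels_def]
  have gl: "gluonic (FF \<mu> \<nu>)" "gluonic (AA \<mu>)" for \<mu> \<nu>
    by (simp_all add: gluonic_def)
  \<comment> \<open>The signs \<eta>_\<nu>\<nu> square to 1, so a statement on the lowered index of
    A yields the one on the upper index.\<close>
  have eta_cancel: "e = cst (eta \<nu> \<nu>) * e'" if "cst (eta \<nu> \<nu>) * e = e'" for \<nu> and e e' :: "'a expr"
    using that cst_eta_square_left[of \<nu> e] by simp
  have FA: "(\<Sum>\<mu>\<in>UNIV. G p q \<mu> (FF \<mu> \<nu>) (AA \<kappa>)) =
      cst (- \<i>) * (cst (eta \<nu> \<kappa>) * delta p q - ker_dup p q {#} {#\<nu>#} \<kappa>)" if "p \<noteq> q" for p q \<nu> \<kappa>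
    by (rule G_parts[THEN conjunct1, rule_format, OF that, THEN conjunct2, THEN conjunct1, rule_format])
  show "p \<noteq> q \<Longrightarrow> (\<Sum>\<mu>\<in>UNIV. dpart (O2 p q \<mu> (FF \<mu> \<nu>) a (AA \<kappa>) b)) =
      cst (kron a b) * (cst (- \<i>) * (cst (eta \<nu> \<kappa>) * delta p q))"
    using arg_cong[OF FA[of p q \<nu> \<kappa>], of dpart]
    by (simp add: O2 gl dpart_sum dpart_mult dpart_diff dpart_ker_dup flip: sum_distrib_left)
  have "dpart (G_A_lo G p q \<mu> \<nu> (AA \<kappa>)) = 0" if "p \<noteq> q" for p q \<mu> \<nu> \<kappa>
    using G_parts[THEN conjunct1, rule_format, OF that] by (elim conjE allE)
  then have "dpart (G p q \<mu> (AA \<nu>) (AA \<kappa>)) = 0" if "p \<noteq> q" for p q \<mu> \<nu> \<kappa>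
    using that eta_cancel[of \<nu> "dpart (G p q \<mu> (AA \<nu>) (AA \<kappa>))" 0]
    by (simp add: G_A_lo_eq dpart_mult)
  then show "p \<noteq> q \<Longrightarrow> dpart (O2 p q \<mu> (AA \<nu>) a (AA \<kappa>) b) = 0"
    by (simp add: O2 gl dpart_mult)
  obtain k where k: "\<forall>p q \<mu> \<nu> \<kappa> l. p \<noteq> q \<longrightarrow> dpart (G_A_lo G p q \<mu> \<nu> (FF \<kappa> l)) =
      cst (k * (kron \<mu> \<kappa> * kron \<nu> l - kron \<mu> l * kron \<nu> \<kappa>) * \<i>) * delta p q"
    using G_parts[THEN conjunct2] by (elim exE)
  have "dpart (G p q \<mu> (AA \<nu>) (FF \<kappa> l)) = cst (eta \<nu> \<nu>) *
      (cst (k * (kron \<mu> \<kappa> * kron \<nu> l - kron \<mu> l * kron \<nu> \<kappa>) * \<i>) * delta p q)" if "p \<noteq> q" for p q \<mu> \<nu> \<kappa> l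
    using k[rule_format, OF that] by (intro eta_cancel) (simp add: G_A_lo_eq dpart_mult)
  then show "\<exists>k. \<forall>p q \<mu> \<nu> \<kappa> l a b. p \<noteq> q \<longrightarrow> dpart (O2 p q \<mu> (AA \<nu>) a (FF \<kappa> l) b) =
      cst (kron a b) * (cst (eta \<nu> \<nu>) * (cst (k * (kron \<mu> \<kappa> * kron \<nu> l - kron \<mu> l * kron \<nu> \<kappa>) * \<i>) * delta p q))"
    by (intro exI[of _ k]) (simp add: O2 gl dpart_mult)
  show "O2 p q \<mu> WW a \<psi> b = 0" if "p \<noteq> q"
    using O2_parts[THEN conjunct2, rule_format, OF that] by (elim conjE allE)
  have "O2 p q \<mu> (AA \<nu>) a (JJ \<kappa>) b = 0 \<and> O2 p q \<mu> (JJ \<kappa>) a (AA \<nu>) b = 0" if "p \<noteq> q"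
    by (rule O2_parts[THEN conjunct2, rule_format, OF that, THEN conjunct2, THEN conjunct2,
          rule_format, OF gl(2)])
  then show "p \<noteq> q \<Longrightarrow> O2 p q \<mu> (AA \<nu>) a (JJ \<kappa>) b = 0"
    and "p \<noteq> q \<Longrightarrow> O2 p q \<mu> (JJ \<kappa>) a (AA \<nu>) b = 0"
    by simp_all
qed

lemma ip_kron: "ip (\<lambda>b. cst (kron a b) * e) Z = e * Z a"
proof -
  have "ip (\<lambda>b. cst (kron a b) * e) Z = (\<Sum>b\<in>UNIV. if b = a then e * Z a else 0)"
    unfolding ip_def by (rule sum.cong) (auto simp: kron_def)
  then show ?thesis by simp
qed

lemma sum_kron: "(\<Sum>\<kappa>\<in>UNIV. \<Sum>l\<in>UNIV. cst (kron \<mu> \<kappa> * kron \<nu> l) * T \<kappa> l) = T \<mu> \<nu>"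
  for \<mu> \<nu> :: "'i::finite"
proof -
  have "(\<Sum>l\<in>UNIV. cst (kron \<mu> \<kappa> * kron \<nu> l) * T \<kappa> l) = (if \<kappa> = \<mu> then T \<mu> \<nu> else 0)" for \<kappa>
  proof -
    have "(\<Sum>l\<in>UNIV. cst (kron \<mu> \<kappa> * kron \<nu> l) * T \<kappa> l)
        = (\<Sum>l\<in>UNIV. if l = \<nu> then cst (kron \<mu> \<kappa>) * T \<kappa> \<nu> else 0)"
      by (rule sum.cong) (auto simp: kron_def)
    then show ?thesis by (simp add: kron_def)
  qed
  then show ?thesis by simp
qed

section \<open>Vanishing of the quartic invariants\<close>

lemma sum_antisym_zero:
  fixes t :: "'i \<Rightarrow> 'i \<Rightarrow> 'g expr"
  assumes "\<And>\<mu> \<nu>. t \<mu> \<nu> = - t \<nu> \<mu>"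
  shows "(\<Sum>\<mu>\<in>S. \<Sum>\<nu>\<in>S. t \<mu> \<nu>) = 0"
proof (rule expr_eq_uminus)
  have "(\<Sum>\<mu>\<in>S. \<Sum>\<nu>\<in>S. t \<mu> \<nu>) = (\<Sum>\<nu>\<in>S. \<Sum>\<mu>\<in>S. t \<mu> \<nu>)" by (rule sum.swap)
  also have "\<dots> = (\<Sum>\<nu>\<in>S. \<Sum>\<mu>\<in>S. - t \<nu> \<mu>)" by (intro sum.cong refl assms)
  finally show "(\<Sum>\<mu>\<in>S. \<Sum>\<nu>\<in>S. t \<mu> \<nu>) = - (\<Sum>\<mu>\<in>S. \<Sum>\<nu>\<in>S. t \<mu> \<nu>)"
    by (simp add: sum_negf)
qed

text \<open>Invariance moves A^\<mu> across the pairing. Up to a sign symmetric in \<mu> and \<nu>,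
  the summand becomes the expression of \<open>ip_double_bracket_antisym\<close>; it is
  antisymmetric, and the double sum vanishes.\<close>

lemma quartic_A_identity:
  assumes "simple_lie_algebra f"
  shows "(\<Sum>\<mu>\<in>UNIV. \<Sum>\<nu>\<in>UNIV.
    ip (ibracket f (Au p \<mu>) (ibracket f (Al p \<mu>) (Al p \<nu>))) (ibracket f (w0 p) (Au p \<nu>))) = 0"
proof (rule sum_antisym_zero)
  let ?A = "Au p"
  have expand: "ip (ibracket f (Au p \<mu>) (ibracket f (Al p \<mu>) (Al p \<nu>))) (ibracket f (w0 p) (Au p \<nu>))
      = - cst (eta \<mu> \<mu>) * cst (eta \<nu> \<nu>)
        * ip (ibracket f (ibracket f (w0 p) (?A \<nu>)) (?A \<mu>)) (ibracket f (?A \<nu>) (?A \<mu>))" for \<mu> \<nu>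
  proof -
    have "ip (ibracket f (ibracket f (w0 p) (?A \<nu>)) (?A \<mu>)) (ibracket f (?A \<nu>) (?A \<mu>))
        = - ip (ibracket f (ibracket f (w0 p) (?A \<nu>)) (?A \<mu>)) (ibracket f (?A \<mu>) (?A \<nu>))"
      unfolding ip_uminus_right[symmetric] ibracket_antisym[OF assms, of "?A \<nu>" "?A \<mu>"] ..
    moreover have "ip (ibracket f (?A \<mu>) (ibracket f (Al p \<mu>) (Al p \<nu>))) (ibracket f (w0 p) (?A \<nu>))
        = ip (ibracket f (ibracket f (w0 p) (?A \<nu>)) (?A \<mu>)) (ibracket f (Al p \<mu>) (Al p \<nu>))"
      unfolding ip_ibracket[OF assms, of "ibracket f (w0 p) (?A \<nu>)"] by (rule ip_commute)
    ultimately show ?thesis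
      by (simp add: A_lo_eq ibracket_mult_left ibracket_mult_right ip_mult_right mult_ac)
  qed
  show "ip (ibracket f (Au p \<mu>) (ibracket f (Al p \<mu>) (Al p \<nu>))) (ibracket f (w0 p) (Au p \<nu>))
      = - ip (ibracket f (Au p \<nu>) (ibracket f (Al p \<nu>) (Al p \<mu>))) (ibracket f (w0 p) (Au p \<mu>))" for \<mu> \<nu>
    unfolding expand
    by (subst ip_double_bracket_antisym[OF assms]) (simp add: mult_ac)
qed

text \<open>Here each summand vanishes separately: the lowered bracket is a sign times B =
  i[A^\<mu>,A^\<nu>], and B pairs to zero with i[w,B].\<close>

lemma quartic_A_identity':
  assumes "simple_lie_algebra f"
  shows "(\<Sum>\<mu>\<in>UNIV. \<Sum>\<nu>\<in>UNIV.
    ip (ibracket f (Au p \<mu>) (Au p \<nu>)) (ibracket f (w0 p) (ibracket f (Al p \<mu>) (Al p \<nu>)))) = 0"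
proof (intro sum.neutral ballI)
  fix \<mu> \<nu>
  let ?B = "ibracket f (Au p \<mu>) (Au p \<nu>)"
  have "ip ?B (ibracket f (w0 p) ?B) = 0"
    unfolding ip_commute[of ?B] by (rule ip_ibracket_same[OF assms])
  then show "ip ?B (ibracket f (w0 p) (ibracket f (Al p \<mu>) (Al p \<nu>))) = 0"
    by (simp add: A_lo_eq ibracket_mult_left ibracket_mult_right ip_mult_right)
qed

section \<open>Contractions with the interaction terms\<close>

lemma repl_L2:
  assumes "simple_lie_algebra f"
  shows "repl (plain_at q h) (L2 f cF q) = cst (- 2 * (1 + cF)) *
    (\<Sum>\<mu>\<in>UNIV. \<Sum>\<nu>\<in>UNIV. ip (ibracket f (h (AA \<mu>)) (Au q \<nu>)) (ibracket f (Al q \<mu>) (Al q \<nu>)))"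
proof -
  let ?t = "\<lambda>\<mu> \<nu>. ip (ibracket f (h (AA \<mu>)) (Au q \<nu>)) (ibracket f (Al q \<mu>) (Al q \<nu>))"
  let ?t' = "\<lambda>\<mu> \<nu>. ip (ibracket f (Au q \<mu>) (h (AA \<nu>))) (ibracket f (Al q \<mu>) (Al q \<nu>))"
  \<comment> \<open>Both brackets change sign when their entries are exchanged, so replacing the
    second entry is replacing the first with the indices renamed.\<close>
  have t': "?t' \<mu> \<nu> = ?t \<nu> \<mu>" for \<mu> \<nu>
  proof -
    have "ibracket f (Au q \<mu>) (h (AA \<nu>)) = (\<lambda>c. - ibracket f (h (AA \<nu>)) (Au q \<mu>) c)"
      and "ibracket f (Al q \<mu>) (Al q \<nu>) = (\<lambda>c. - ibracket f (Al q \<nu>) (Al q \<mu>) c)"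
      using ibracket_antisym[OF assms] by blast+
    then show ?thesis by (simp only: ip_uminus_left ip_uminus_right minus_minus)
  qed
  have swap: "(\<Sum>\<mu>\<in>UNIV. \<Sum>\<nu>\<in>UNIV. ?t' \<mu> \<nu>) = (\<Sum>\<mu>\<in>UNIV. \<Sum>\<nu>\<in>UNIV. ?t \<mu> \<nu>)"
    unfolding t' by (rule sum.swap)
  \<comment> \<open>The two lowered factors A repeat the terms of the upper ones, since the metric
    signs can be shifted to the other bracket and the pairing is symmetric.\<close>
  have summand: "repl (plain_at q h) (ip (ibracket f (Au q \<mu>) (Au q \<nu>)) (ibracket f (Al q \<mu>) (Al q \<nu>)))
      = 2 * (?t \<mu> \<nu> + ?t' \<mu> \<nu>)" for \<mu> \<nu>
  proof -
    let ?B = "ibracket f (Au q \<mu>) (Au q \<nu>)"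
    have "ip ?B (ibracket f (\<lambda>a. cst (eta \<mu> \<mu>) * h (AA \<mu>) a) (Al q \<nu>)) = ?t \<mu> \<nu>"
      unfolding ip_commute[of ?B]
      by (simp add: A_lo_eq ibracket_mult_left ibracket_mult_right ip_mult_left ip_mult_right)
    moreover have "ip ?B (ibracket f (Al q \<mu>) (\<lambda>a. cst (eta \<nu> \<nu>) * h (AA \<nu>) a)) = ?t' \<mu> \<nu>"
      unfolding ip_commute[of ?B]
      by (simp add: A_lo_eq ibracket_mult_left ibracket_mult_right ip_mult_left ip_mult_right)
    ultimately show ?thesis
      by (simp only: repl_ip repl_ibracket repl_plain_at_fields ip_add_left ip_add_right mult_2)
  qed
  \<comment> \<open>All four factors A of L_2 contribute equally, hence 4 times -1/2.\<close>
  have four: "cst (- (1/2) * (1 + cF)) * 4 = cst (- 2 * (1 + cF))"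
    unfolding cst_numeral[symmetric] cst_mult[symmetric]
    by (rule arg_cong[where f = cst]) (simp add: field_simps)
  have "repl (plain_at q h) (L2 f cF q) = cst (- (1/2) * (1 + cF)) *
      (2 * ((\<Sum>\<mu>\<in>UNIV. \<Sum>\<nu>\<in>UNIV. ?t \<mu> \<nu>) + (\<Sum>\<mu>\<in>UNIV. \<Sum>\<nu>\<in>UNIV. ?t' \<mu> \<nu>)))"
    unfolding L2_def repl_mult repl_cst repl_sum summand
    by (simp add: sum.distrib sum_distrib_left)
  also have "\<dots> = cst (- (1/2) * (1 + cF)) * 4 * (\<Sum>\<mu>\<in>UNIV. \<Sum>\<nu>\<in>UNIV. ?t \<mu> \<nu>)"
    unfolding swap by (simp add: mult.assoc)
  finally show ?thesis unfolding four .
qed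

text \<open>If nothing is contracted with A and j, only the F of the cubic coupling is
  replaced.\<close>

lemma repl_L1:
  assumes "\<And>\<mu> a. h (AA \<mu>) a = 0" and "\<And>\<mu> a. h (JJ \<mu>) a = 0"
  shows "repl (plain_at q h) (L1 f q) = cst (1/2) *
    (\<Sum>\<mu>\<in>UNIV. \<Sum>\<nu>\<in>UNIV. ip (h (FF \<mu> \<nu>)) (ibracket f (Al q \<mu>) (Al q \<nu>)))"
  unfolding L1_def
  by (simp add: repl_add repl_mult repl_sum repl_ip repl_ibracket assms)

text \<open>L_2 contains only A, whose \<delta>-contractions with the fields A, w and j of Q_1
  vanish; F with A remains. The uncontracted fields stay at their own points x and x' for
  now.\<close>

lemma dpart_O_Q1_L2:
  assumes f: "simple_lie_algebra f" and O2: "two_point_obstructions f cF O2"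
  shows "dpart (O_Q1_L2 f cF O2) = cst (complex_of_real (- 2 * (1 + cF)) * \<i>) * delta X0 X1 *
    (\<Sum>\<mu>\<in>UNIV. \<Sum>\<nu>\<in>UNIV.
      ip (ibracket f (Au X1 \<mu>) (ibracket f (Al X1 \<mu>) (Al X1 \<nu>))) (ibracket f (w0 X0) (Au X0 \<nu>)))"
proof -
  note contr = dpart_contractions[OF O2]
  \<comment> \<open>\<open>H \<mu> \<phi> a\<close> is what a field of Q_1 is replaced by: its
    contraction with all of L_2.\<close>
  define H where "H \<mu> \<phi> a =
    repl (plain_at X1 (\<lambda>\<psi> b. dpart (O2 X0 X1 \<mu> \<phi> a \<psi> b))) (L2 f cF X1)" for \<mu> \<phi> a
  have H_vanish: "H \<mu> (AA \<nu>) a = 0" "H \<mu> WW a = 0" "H \<mu> (JJ \<nu>) a = 0" for \<mu> \<nu> a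
    unfolding H_def repl_L2[OF f] by (simp_all add: contr)
  have H_F: "(\<Sum>\<mu>\<in>UNIV. H \<mu> (FF \<mu> \<nu>) a) = cst (2 * (1 + cF) * \<i>) * delta X0 X1 *
      (cst (eta \<nu> \<nu>) * (\<Sum>\<kappa>\<in>UNIV. ibracket f (Au X1 \<kappa>) (ibracket f (Al X1 \<nu>) (Al X1 \<kappa>)) a))"
    for \<nu> a
  proof -
    \<comment> \<open>The colour delta evaluates the pairing at \<open>a\<close>, and the diagonal
      metric leaves only \<mu> = \<nu>.\<close>
    have summand: "ip (ibracket f (\<lambda>b. cst (kron a b) * (cst (- \<i>) * (cst (eta \<nu> \<mu>) * delta X0 X1))) (Au X1 \<kappa>))
          (ibracket f (Al X1 \<mu>) (Al X1 \<kappa>))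
        = (if \<mu> = \<nu> then cst (- \<i>) * delta X0 X1 *
            (cst (eta \<nu> \<nu>) * ibracket f (Au X1 \<kappa>) (ibracket f (Al X1 \<nu>) (Al X1 \<kappa>)) a) else 0)" for \<mu> \<kappa>
      unfolding ip_ibracket[OF f] ip_kron by (auto simp: eta_def mult_ac)
    have "(\<Sum>\<mu>\<in>UNIV. H \<mu> (FF \<mu> \<nu>) a) = cst (- 2 * (1 + cF)) *
        (\<Sum>\<mu>\<in>UNIV. \<Sum>\<kappa>\<in>UNIV. if \<mu> = \<nu> then cst (- \<i>) * delta X0 X1 *
            (cst (eta \<nu> \<nu>) * ibracket f (Au X1 \<kappa>) (ibracket f (Al X1 \<nu>) (Al X1 \<kappa>)) a) else 0)"
      unfolding H_def repl_plain_at_sum[symmetric]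
      unfolding repl_L2[OF f] contr(1)[OF point.distinct(1)] summand ..
    also have "\<dots> = cst (- 2 * (1 + cF)) *
        (\<Sum>\<mu>\<in>UNIV. if \<mu> = \<nu> then (\<Sum>\<kappa>\<in>UNIV. cst (- \<i>) * delta X0 X1 *
            (cst (eta \<nu> \<nu>) * ibracket f (Au X1 \<kappa>) (ibracket f (Al X1 \<nu>) (Al X1 \<kappa>)) a)) else 0)"
      by (intro arg_cong[where f = "\<lambda>e. _ * e"] sum.cong[OF refl]) simp
    also have "\<dots> = cst (- 2 * (1 + cF)) * cst (- \<i>) * delta X0 X1 *
      (cst (eta \<nu> \<nu>) * (\<Sum>\<kappa>\<in>UNIV. ibracket f (Au X1 \<kappa>) (ibracket f (Al X1 \<nu>) (Al X1 \<kappa>)) a))"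
      by (simp add: mult.assoc flip: sum_distrib_left)
    also have "cst (- 2 * (1 + cF)) * cst (- \<i>) = cst (2 * (1 + cF) * \<i>)"
      unfolding cst_mult[symmetric] by (rule arg_cong[where f = cst]) (simp add: algebra_simps)
    finally show ?thesis .
  qed
  have "dpart (O_Q1_L2 f cF O2) = (\<Sum>\<mu>\<in>UNIV. repl (plain_at X0 (H \<mu>)) (Q1 f X0 \<mu>))"
    unfolding O_Q1_L2_def dpart_obst dpart_interaction unfolding obst_def H_def ..
  also have "\<dots> = (\<Sum>\<mu>\<in>UNIV. \<Sum>\<nu>\<in>UNIV. ip (H \<mu> (FF \<mu> \<nu>)) (ibracket f (w0 X0) (Al X0 \<nu>)))"
    by (simp add: Q1_def repl_add repl_sum repl_ip repl_ibracket H_vanish)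
  also have "\<dots> = (\<Sum>\<nu>\<in>UNIV. ip (\<lambda>a. \<Sum>\<mu>\<in>UNIV. H \<mu> (FF \<mu> \<nu>) a) (ibracket f (w0 X0) (Al X0 \<nu>)))"
    unfolding ip_sum_left by (rule sum.swap)
  \<comment> \<open>One sign \<eta>_\<nu>\<nu> comes from the contraction, the other from the
    lowered A of Q_1; they cancel and leave an upper index.\<close>
  also have "\<dots> = cst (2 * (1 + cF) * \<i>) * delta X0 X1 * (\<Sum>\<nu>\<in>UNIV. \<Sum>\<mu>\<in>UNIV.
      ip (ibracket f (Au X1 \<mu>) (ibracket f (Al X1 \<nu>) (Al X1 \<mu>))) (ibracket f (w0 X0) (Au X0 \<nu>)))"
    unfolding H_F ip_mult_left ip_sum_left A_lo_eq[of _ _ X0] ibracket_mult_right ip_mult_right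
      sum_distrib_left[symmetric] cst_eta_square_left ..
  \<comment> \<open>Reversing the inner bracket gives the order of
    \<open>quartic_A_identity\<close>; the sign then goes into the constant.\<close>
  also have "\<dots> = cst (2 * (1 + cF) * \<i>) * delta X0 X1 * - (\<Sum>\<nu>\<in>UNIV. \<Sum>\<mu>\<in>UNIV.
      ip (ibracket f (Au X1 \<mu>) (ibracket f (Al X1 \<mu>) (Al X1 \<nu>))) (ibracket f (w0 X0) (Au X0 \<nu>)))"
  proof -
    have "ip (ibracket f (Au X1 \<mu>) (ibracket f (Al X1 \<nu>) (Al X1 \<mu>))) (ibracket f (w0 X0) (Au X0 \<nu>))
        = - ip (ibracket f (Au X1 \<mu>) (ibracket f (Al X1 \<mu>) (Al X1 \<nu>))) (ibracket f (w0 X0) (Au X0 \<nu>))"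
      for \<mu> \<nu>
      unfolding ip_uminus_left[symmetric] fun_cong[OF ibracket_uminus_right, symmetric]
        ibracket_antisym[OF f, of "Al X1 \<nu>" "Al X1 \<mu>", abs_def] ..
    then show ?thesis by (simp add: sum_negf)
  qed
  also have "\<dots> = cst (complex_of_real (- 2 * (1 + cF)) * \<i>) * delta X0 X1 * (\<Sum>\<nu>\<in>UNIV. \<Sum>\<mu>\<in>UNIV.
      ip (ibracket f (Au X1 \<mu>) (ibracket f (Al X1 \<mu>) (Al X1 \<nu>))) (ibracket f (w0 X0) (Au X0 \<nu>)))"
  proof -
    have "cst (complex_of_real (- 2 * (1 + cF)) * \<i>) = (- cst (2 * (1 + cF) * \<i>) :: 'a expr)"
      unfolding cst_uminus[symmetric] by (rule arg_cong[where f = cst]) (simp add: algebra_simps)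
    then show ?thesis by (simp only: mult_minus_left mult_minus_right)
  qed
  also have "\<dots> = cst (complex_of_real (- 2 * (1 + cF)) * \<i>) * delta X0 X1 * (\<Sum>\<mu>\<in>UNIV. \<Sum>\<nu>\<in>UNIV.
      ip (ibracket f (Au X1 \<mu>) (ibracket f (Al X1 \<mu>) (Al X1 \<nu>))) (ibracket f (w0 X0) (Au X0 \<nu>)))"
    by (rule arg_cong[OF sum.swap])
  finally show ?thesis .
qed

text \<open>The only surviving \<delta>-contraction is that of an A in the coefficient with the F of
  L_1. Of the three factors A, the first gives zero and the other two give the two sums; all
  constants are absorbed in \<open>k\<close>.\<close>

lemma obst_Q2_delta_coeff_L1:
  assumes f: "simple_lie_algebra f" and O2: "two_point_obstructions f cF O2"
  obtains k where "obst (\<lambda>p q \<mu> \<phi> a \<psi> b. dpart (O2 p q \<mu> \<phi> a \<psi> b)) X0 X2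
      (Q2_delta_coeff f cF X0) (L1 f X2) = cst k * delta X0 X2 *
    ((\<Sum>\<mu>\<in>UNIV. \<Sum>\<nu>\<in>UNIV.
      ip (ibracket f (Au X0 \<mu>) (ibracket f (Al X2 \<mu>) (Al X2 \<nu>))) (ibracket f (w0 X0) (Au X0 \<nu>)))
    + (\<Sum>\<mu>\<in>UNIV. \<Sum>\<nu>\<in>UNIV.
      ip (ibracket f (Au X0 \<mu>) (Au X0 \<nu>)) (ibracket f (w0 X0) (ibracket f (Al X2 \<mu>) (Al X2 \<nu>)))))"
proof -
  note contr = dpart_contractions[OF O2]
  let ?A = "Au X0" and ?B = "\<lambda>\<mu> \<nu>. ibracket f (Al X2 \<mu>) (Al X2 \<nu>)" and ?w = "w0 X0"
  obtain k where k: "\<And>p q \<mu> \<nu> \<kappa> l a b. p \<noteq> q \<Longrightarrow> dpart (O2 p q \<mu> (AA \<nu>) a (FF \<kappa> l) b) =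
      cst (kron a b) * (cst (eta \<nu> \<nu>) *
        (cst (k * (kron \<mu> \<kappa> * kron \<nu> l - kron \<mu> l * kron \<nu> \<kappa>) * \<i>) * delta p q))"
    using contr(3) by (elim exE) (rule that, blast)
  define H where "H \<mu> \<phi> a =
    repl (plain_at X2 (\<lambda>\<psi> b. dpart (O2 X0 X2 \<mu> \<phi> a \<psi> b))) (L1 f X2)" for \<mu> \<phi> a
  have H_W: "H \<mu> WW a = 0" for \<mu> a
    unfolding H_def by (simp add: contr repl_L1)
  have H_A: "H \<mu> (AA \<nu>) a = cst (k * \<i>) * delta X0 X2 * (cst (eta \<nu> \<nu>) * ?B \<mu> \<nu> a)" for \<mu> \<nu> a
  proof -
    let ?c = "cst (k * \<i>) * delta X0 X2 * cst (eta \<nu> \<nu>)"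
    \<comment> \<open>The minus sign of the second Kronecker product is absorbed by reversing the
      bracket. Both products then contribute equally, which cancels the 1/2 of L_1.\<close>
    have summand: "ip (\<lambda>b. cst (kron a b) * (cst (eta \<nu> \<nu>) *
          (cst (k * (kron \<mu> \<kappa> * kron \<nu> l - kron \<mu> l * kron \<nu> \<kappa>) * \<i>) * delta X0 X2))) (?B \<kappa> l)
        = ?c * (cst (kron \<mu> \<kappa> * kron \<nu> l) * ?B \<kappa> l a) + ?c * (cst (kron \<nu> \<kappa> * kron \<mu> l) * ?B l \<kappa> a)"
      for \<kappa> l
      unfolding ip_kron ibracket_antisym[OF f, of "Al X2 l" "Al X2 \<kappa>"]
      by (simp add: cst_mult cst_diff algebra_simps)
    have "H \<mu> (AA \<nu>) a = cst (1/2) * (\<Sum>\<kappa>\<in>UNIV. \<Sum>l\<in>UNIV.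
        ?c * (cst (kron \<mu> \<kappa> * kron \<nu> l) * ?B \<kappa> l a) + ?c * (cst (kron \<nu> \<kappa> * kron \<mu> l) * ?B l \<kappa> a))"
      unfolding H_def by (subst repl_L1) (simp_all only: contr dpart_0 k summand point.distinct not_False_eq_True)
    also have "\<dots> = cst (1/2) * (?c * ?B \<mu> \<nu> a + ?c * ?B \<mu> \<nu> a)"
      unfolding sum.distrib sum_distrib_left[symmetric] sum_kron[of _ _ "\<lambda>\<kappa> l. ?B \<kappa> l a"]
        sum_kron[of _ _ "\<lambda>\<kappa> l. ?B l \<kappa> a"] ..
    also have "\<dots> = cst (1/2) * cst 2 * (?c * ?B \<mu> \<nu> a)"
      by (simp add: cst_numeral)
    also have "\<dots> = ?c * ?B \<mu> \<nu> a"
      unfolding cst_mult[symmetric] by simp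
    finally show ?thesis by (simp add: mult.assoc)
  qed
  let ?c = "cst (k * \<i>) * delta X0 X2"
  \<comment> \<open>The first A^\<mu> carries the contraction index itself, so it produces
    i[A_\<mu>,A_\<mu>] = 0.\<close>
  have diag: "ip (ibracket f (H \<mu> (AA \<mu>)) (?A \<nu>)) Z = 0" for \<mu> \<nu> Z
  proof -
    have "H \<mu> (AA \<mu>) = (\<lambda>a. 0)"
      by (rule ext) (simp add: H_A ibracket_self[OF f])
    then show ?thesis by simp
  qed
  have second: "ip (ibracket f (?A \<mu>) (H \<mu> (AA \<nu>))) (ibracket f ?w (Al X0 \<nu>))
      = ?c * ip (ibracket f (?A \<mu>) (?B \<mu> \<nu>)) (ibracket f ?w (?A \<nu>))" for \<mu> \<nu>
    unfolding H_A A_lo_eq[of _ _ X0] ibracket_mult_right ip_mult_left ip_mult_right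
      mult.left_commute[of "cst (eta \<nu> \<nu>)" ?c] cst_eta_square_left ..
  have third: "ip (ibracket f (?A \<mu>) (?A \<nu>)) (ibracket f ?w (\<lambda>a. cst (eta \<nu> \<nu>) * H \<mu> (AA \<nu>) a))
      = ?c * ip (ibracket f (?A \<mu>) (?A \<nu>)) (ibracket f ?w (?B \<mu> \<nu>))" for \<mu> \<nu>
    unfolding H_A mult.left_commute[of "cst (eta \<nu> \<nu>)"] cst_eta_square_left
      ibracket_mult_right ip_mult_right ..
  have "obst (\<lambda>p q \<mu> \<phi> a \<psi> b. dpart (O2 p q \<mu> \<phi> a \<psi> b)) X0 X2 (Q2_delta_coeff f cF X0) (L1 f X2)
      = (\<Sum>\<mu>\<in>UNIV. repl (plain_at X0 (H \<mu>)) (Q2_delta_coeff f cF X0 \<mu>))"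
    unfolding obst_def H_def ..
  also have "\<dots> = (\<Sum>\<mu>\<in>UNIV. cst (- 2 * (1 + cF)) * (\<Sum>\<nu>\<in>UNIV.
      ?c * ip (ibracket f (?A \<mu>) (?B \<mu> \<nu>)) (ibracket f ?w (?A \<nu>))
      + ?c * ip (ibracket f (?A \<mu>) (?A \<nu>)) (ibracket f ?w (?B \<mu> \<nu>))))"
    unfolding Q2_delta_coeff_def
    by (simp only: repl_mult repl_cst repl_sum repl_ip repl_ibracket repl_plain_at_fields H_W
        ip_add_left ip_add_right ibracket_zero_left ip_zero_right diag second third
        mult_zero_left add_0_left)
  also have "\<dots> = cst (- 2 * (1 + cF)) * (?c *
    ((\<Sum>\<mu>\<in>UNIV. \<Sum>\<nu>\<in>UNIV. ip (ibracket f (?A \<mu>) (?B \<mu> \<nu>)) (ibracket f ?w (?A \<nu>)))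
    + (\<Sum>\<mu>\<in>UNIV. \<Sum>\<nu>\<in>UNIV. ip (ibracket f (?A \<mu>) (?A \<nu>)) (ibracket f ?w (?B \<mu> \<nu>)))))"
    by (simp only: sum.distrib sum_distrib_left[symmetric] distrib_left[symmetric])
  finally show ?thesis
    by (intro that[of "complex_of_real (- 2 * (1 + cF)) * (k * \<i>)"])
      (simp only: cst_mult mult.assoc)
qed

section \<open>Expressions that vanish as distributions\<close>

locale vanishing_expressions =
  fixes N :: "'g::finite expr set"
  assumes N: "expression_identities N"
begin

lemma N_zero: "0 \<in> N"
  using N unfolding expression_identities_def by (elim conjE)

lemma N_add: "e \<in> N \<Longrightarrow> e' \<in> N \<Longrightarrow> e + e' \<in> N"
  using N unfolding expression_identities_def by (elim conjE) blast

lemma N_mult: "e \<in> N \<Longrightarrow> g * e \<in> N"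
  using N unfolding expression_identities_def by (elim conjE) blast

lemma N_mult_right: "e \<in> N \<Longrightarrow> e * g \<in> N"
  using N_mult by (simp add: mult.commute)

lemma N_sum: "(\<And>i. i \<in> S \<Longrightarrow> h i \<in> N) \<Longrightarrow> sum h S \<in> N"
  by (induction S rule: infinite_finite_induct) (simp_all add: N_zero N_add)

lemma N_sym3: "e \<in> N \<Longrightarrow> sym3 e \<in> N"
  unfolding sym3_def
  using N unfolding expression_identities_def
  by (intro N_mult N_sum) blast

lemma N_div_sym:
  assumes "\<And>\<mu>. U \<mu> \<in> N"
  shows "div_sym U \<in> N"
proof -
  have "der p \<mu> e \<in> N" if "e \<in> N" for p \<mu> e
    using N that unfolding expression_identities_def by (elim conjE) blast
  then show ?thesis
    unfolding div_sym_def using assms by (intro N_sym3 N_sum) blast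
qed

lemma N_kernel: "kernel_identities N"
  using N unfolding expression_identities_def by (elim conjE)

text \<open>Equality on the diagonal, encoded by a delta factor instead of a substitution of points.
  It respects sums and products, so the rule of \<open>kernel_identities\<close> for single fields
  extends to polynomials in them.\<close>

definition coincident :: "point \<Rightarrow> point \<Rightarrow> 'g expr \<Rightarrow> 'g expr \<Rightarrow> bool" where
  "coincident p q e e' \<longleftrightarrow> (e - e') * delta p q \<in> N"

lemma coincident_refl: "coincident p q e e"
  by (simp add: coincident_def N_zero)

lemma coincident_add:
  "coincident p q a a' \<Longrightarrow> coincident p q b b' \<Longrightarrow> coincident p q (a + b) (a' + b')"
  unfolding coincident_def by (drule (1) N_add) (simp add: algebra_simps)

lemma coincident_mult:
  assumes "coincident p q a a'" and "coincident p q b b'"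
  shows "coincident p q (a * b) (a' * b')"
proof -
  \<comment> \<open>This telescopes to \<open>(a * b - a' * b') * delta p q\<close>.\<close>
  have "b * ((a - a') * delta p q) + a' * ((b - b') * delta p q) \<in> N"
    using N_add[OF N_mult N_mult] assms unfolding coincident_def by blast
  then show ?thesis by (simp add: coincident_def algebra_simps)
qed

lemma coincident_sum:
  "(\<And>i. i \<in> S \<Longrightarrow> coincident p q (h i) (h' i)) \<Longrightarrow> coincident p q (sum h S) (sum h' S)"
  by (induction S rule: infinite_finite_induct) (simp_all add: coincident_refl coincident_add)

lemma coincident_ip:
  "(\<And>a. coincident p q (X a) (X' a)) \<Longrightarrow> (\<And>a. coincident p q (Y a) (Y' a)) \<Longrightarrow>
    coincident p q (ip X Y) (ip X' Y')"
  unfolding ip_def by (intro coincident_sum coincident_mult)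

lemma coincident_ibracket:
  "(\<And>a. coincident p q (X a) (X' a)) \<Longrightarrow> (\<And>a. coincident p q (Y a) (Y' a)) \<Longrightarrow>
    coincident p q (ibracket f X Y c) (ibracket f X' Y' c)"
  unfolding ibracket_def lbracket_def
  by (intro coincident_sum coincident_mult coincident_refl)

lemma coincident_fields:
  assumes "p \<noteq> q"
  shows "coincident p q (A_up S D p \<mu> a) (A_up S D q \<mu> a)"
    and "coincident p q (w_fld S D p a) (w_fld S D q a)"
  using N_kernel assms
  unfolding kernel_identities_def coincident_def A_up_def w_fld_def by blast+

lemma coincident_zero:
  assumes "coincident p q e e'" and "e' = 0"
  shows "e * delta p q \<in> N"
  using assms by (simp add: coincident_def)

text \<open>The factor \<delta>(x - x') moves w and A from x to x', where
  \<open>quartic_A_identity\<close> applies. Symmetrization is not involved.\<close>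

lemma first_contribution_vanishes:
  assumes f: "simple_lie_algebra f" and O2: "two_point_obstructions f cF O2"
  shows "dpart (O_Q1_L2 f cF O2) \<in> N"
proof -
  have "(\<Sum>\<mu>\<in>UNIV. \<Sum>\<nu>\<in>UNIV. ip (ibracket f (Au X1 \<mu>) (ibracket f (Al X1 \<mu>) (Al X1 \<nu>)))
      (ibracket f (w0 X0) (Au X0 \<nu>))) * delta X0 X1 \<in> N"
    by (rule coincident_zero[OF _ quartic_A_identity[OF f, of X1]],
        intro coincident_sum coincident_ip coincident_ibracket)
      (simp_all add: coincident_refl coincident_fields)
  from N_mult[OF this, of "cst (complex_of_real (- 2 * (1 + cF)) * \<i>)"] show ?thesis
    unfolding dpart_O_Q1_L2[OF f O2] by (simp only: mult_ac)
qed

text \<open>Each of the two sums vanishes separately once its fields at x are moved to x'', so the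
  value of \<open>k\<close> is immaterial; \<delta>(x - x') is a spectator.\<close>

lemma second_contribution_vanishes:
  assumes f: "simple_lie_algebra f" and O2: "two_point_obstructions f cF O2"
  shows "dpart (O_Q2d_L1 f cF O2) \<in> N"
proof -
  obtain k where k: "obst (\<lambda>p q \<mu> \<phi> a \<psi> b. dpart (O2 p q \<mu> \<phi> a \<psi> b)) X0 X2
      (Q2_delta_coeff f cF X0) (L1 f X2) = cst k * delta X0 X2 *
    ((\<Sum>\<mu>\<in>UNIV. \<Sum>\<nu>\<in>UNIV.
      ip (ibracket f (Au X0 \<mu>) (ibracket f (Al X2 \<mu>) (Al X2 \<nu>))) (ibracket f (w0 X0) (Au X0 \<nu>)))
    + (\<Sum>\<mu>\<in>UNIV. \<Sum>\<nu>\<in>UNIV.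
      ip (ibracket f (Au X0 \<mu>) (Au X0 \<nu>)) (ibracket f (w0 X0) (ibracket f (Al X2 \<mu>) (Al X2 \<nu>)))))"
    (is "_ = cst k * delta X0 X2 * (?S + ?T)")
    by (rule obst_Q2_delta_coeff_L1[OF f O2])
  have "?S * delta X0 X2 \<in> N"
    by (rule coincident_zero[OF _ quartic_A_identity[OF f, of X2]],
        intro coincident_sum coincident_ip coincident_ibracket)
      (simp_all add: coincident_refl coincident_fields)
  moreover have "?T * delta X0 X2 \<in> N"
    by (rule coincident_zero[OF _ quartic_A_identity'[OF f, of X2]],
        intro coincident_sum coincident_ip coincident_ibracket)
      (simp_all add: coincident_refl coincident_fields)
  ultimately have "cst (1/2) * cst k * delta X0 X1 * (?S * delta X0 X2 + ?T * delta X0 X2) \<in> N"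
    by (rule N_mult[OF N_add])
  moreover have "dpart (O_Q2d_L1 f cF O2)
      = cst (1/2) * cst k * delta X0 X1 * (?S * delta X0 X2 + ?T * delta X0 X2)"
    unfolding O_Q2d_L1_def obst_delta_def dpart_mult dpart_obst dpart_interaction dpart_cst dpart_delta k
    by (simp only: mult_ac distrib_left distrib_right)
  ultimately show ?thesis by simp
qed

end

section \<open>Trading delta functions for string-integrated ones\<close>

text \<open>The condition of \<open>three_point\<close> on one monomial, so that kernels can be
  exchanged monomial by monomial.\<close>

definition connecting :: "'g factor multiset \<Rightarrow> bool" where
  "connecting m \<longleftrightarrow> (\<forall>p S S' D. Ker p p S S' D \<notin># m) \<and> (\<exists>v\<in>#m. \<exists>v'\<in>#m. ends v \<union> ends v' = UNIV)"

lemma three_point_iff: "three_point e \<longleftrightarrow> (\<forall>m\<in>Poly_Mapping.keys e. connecting m)"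
  unfolding three_point_def connecting_def ..

lemma three_point_zero: "three_point 0"
  by (simp add: three_point_iff)

lemma three_point_add: "three_point a \<Longrightarrow> three_point b \<Longrightarrow> three_point (a + b)"
  unfolding three_point_iff using Poly_Mapping.keys_add[of a b] by blast

lemma three_point_mult_cst: "three_point a \<Longrightarrow> three_point (cst k * a)"
proof -
  assume a: "three_point a"
  have "Poly_Mapping.keys (cst k * a) \<subseteq> Poly_Mapping.keys a"
  proof
    fix m
    assume "m \<in> Poly_Mapping.keys (cst k * a)"
    then obtain m0 m1 where m: "m = m0 + m1" "m0 \<in> Poly_Mapping.keys (cst k :: 'a expr)" "m1 \<in> Poly_Mapping.keys a"
      using keys_mult[of "cst k" a] by blast
    then have "m0 = {#}" by (simp add: cst_def split: if_splits)
    with m show "m \<in> Poly_Mapping.keys a" by simp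
  qed
  with a show ?thesis unfolding three_point_iff by blast
qed

lemma three_point_sum: "(\<And>i. i \<in> S \<Longrightarrow> three_point (h i)) \<Longrightarrow> three_point (sum h S)"
  by (induction S rule: infinite_finite_induct) (simp_all add: three_point_zero three_point_add)

lemma expr_eq_sum_single: "e = (\<Sum>m\<in>Poly_Mapping.keys e. Poly_Mapping.single m (Poly_Mapping.lookup e m))"
  for e :: "'g expr"
  by (rule poly_mapping_eqI) (simp add: lookup_sum lookup_single when_def in_keys_iff)

lemma three_point_single: "connecting m \<Longrightarrow> three_point (Poly_Mapping.single m c)"
  by (simp add: three_point_iff)

text \<open>Connectedness sees only the endpoints of kernels, so string operators and derivatives
  may be changed freely.\<close>

lemma connecting_replace:
  assumes "connecting (add_mset (Ker p q S S' D) m)" and "p \<noteq> q"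
  shows "connecting (add_mset (Ker p q T T' E) m)"
proof -
  obtain v v' where v: "v \<in># add_mset (Ker p q S S' D) m" "v' \<in># add_mset (Ker p q S S' D) m"
    "ends v \<union> ends v' = UNIV"
    using assms(1) unfolding connecting_def by blast
  have "\<exists>u\<in>#add_mset (Ker p q T T' E) m. ends u = ends v"
    if "v \<in># add_mset (Ker p q S S' D) m" for v
    using that by auto
  from this[OF v(1)] this[OF v(2)] v(3) assms show ?thesis
    unfolding connecting_def by (metis factor.inject(2) insert_iff set_mset_add_mset_insert)
qed

lemma connecting_has_kernel:
  assumes "connecting m"
  obtains p q S S' D m' where "p \<noteq> q" "m = add_mset (Ker p q S S' D) m'"
proof -
  obtain v v' where "v \<in># m" "v' \<in># m" "ends v \<union> ends v' = UNIV"
    using assms unfolding connecting_def by blast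
  then obtain u where u: "u \<in># m" "ends u \<noteq> {}" by blast
  then obtain p q S S' D where "u = Ker p q S S' D"
    by (cases u) auto
  with u assms that show ?thesis
    unfolding connecting_def by (metis insert_DiffM)
qed

context vanishing_expressions
begin

text \<open>Connectedness provides a kernel in the monomial. By \<partial>_\<nu> I^\<nu> = -1 it can
  be traded for minus the sum over \<nu> of kernels with one more I^\<nu> and one more
  \<partial>_\<nu>, all of them string-integrated.\<close>

lemma string_integrate_single:
  assumes "connecting m"
  shows "\<exists>V. three_point V \<and> dpart V = 0 \<and> Poly_Mapping.single m c - V \<in> N"
proof -
  obtain p q S S' D m' where pq: "p \<noteq> q" and m: "m = add_mset (Ker p q S S' D) m'"
    using connecting_has_kernel[OF assms] .
  define V where "V = (\<Sum>\<nu>\<in>UNIV. Poly_Mapping.single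
    (add_mset (Ker p q (add_mset \<nu> S) S' (add_mset \<nu> D)) m') (- c))"
  have "(\<Sum>\<nu>\<in>UNIV. atom (Ker p q (add_mset \<nu> S) S' (add_mset \<nu> D))) + atom (Ker p q S S' D) \<in> N"
    using N_kernel pq unfolding kernel_identities_def by blast
  from N_mult[OF this, of "Poly_Mapping.single m' c"]
  have "Poly_Mapping.single m c - V \<in> N"
    by (simp add: V_def m atom_def distrib_left sum_distrib_left mult_single single_uminus
        sum_negf add.commute)
  moreover have "three_point V"
    unfolding V_def
    by (intro three_point_sum three_point_single connecting_replace[OF assms[unfolded m] pq])
  moreover have "dpart V = 0"
    by (simp add: V_def dpart_sum dpart_single)
  ultimately show ?thesis by blast
qed

lemma string_integrate:
  assumes "three_point U"
  shows "\<exists>V. three_point V \<and> dpart V = 0 \<and> U - V \<in> N"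
proof -
  have "\<forall>m\<in>Poly_Mapping.keys U. \<exists>V. three_point V \<and> dpart V = 0 \<and>
      Poly_Mapping.single m (Poly_Mapping.lookup U m) - V \<in> N"
    using assms string_integrate_single unfolding three_point_iff by blast
  then obtain V where V: "\<And>m. m \<in> Poly_Mapping.keys U \<Longrightarrow> three_point (V m) \<and> dpart (V m) = 0 \<and>
      Poly_Mapping.single m (Poly_Mapping.lookup U m) - V m \<in> N"
    by metis
  have "U - sum V (Poly_Mapping.keys U)
      = (\<Sum>m\<in>Poly_Mapping.keys U. Poly_Mapping.single m (Poly_Mapping.lookup U m) - V m)"
    by (subst expr_eq_sum_single[of U]) (simp add: sum_subtractf)
  also have "\<dots> \<in> N" using V by (intro N_sum) blast
  finally show ?thesis
    using V by (intro exI[of _ "sum V (Poly_Mapping.keys U)"]) (simp add: three_point_sum dpart_sum)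
qed

text \<open>\<open>N\<close> is closed under derivatives and relabelling, so exchanging U for an
  equivalent V changes the symmetrized divergence only by an element of \<open>N\<close>.\<close>

lemma total_derivative_string_integrated:
  assumes "total_derivative N e"
  obtains V where "\<forall>\<mu>. three_point (V \<mu>) \<and> dpart (V \<mu>) = 0" "e - div_sym V \<in> N"
proof -
  obtain U where U: "\<And>\<mu>. three_point (U \<mu>)" "e - div_sym U \<in> N"
    using assms unfolding total_derivative_def by blast
  obtain V where V: "\<And>\<mu>. three_point (V \<mu>) \<and> dpart (V \<mu>) = 0 \<and> U \<mu> - V \<mu> \<in> N"
    using string_integrate[OF U(1)] by metis
  have "div_sym (\<lambda>\<mu>. (U \<mu> - V \<mu>) + V \<mu>) = div_sym (\<lambda>\<mu>. U \<mu> - V \<mu>) + div_sym V"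
    by (rule div_sym_add)
  then have "div_sym U - div_sym V = div_sym (\<lambda>\<mu>. U \<mu> - V \<mu>)" by simp
  also have "\<dots> \<in> N" using V by (intro N_div_sym) blast
  finally have "e - div_sym V \<in> N"
    using N_add[OF U(2)] by force
  with V show ?thesis by (intro that[of V]) blast+
qed

end

section \<open>The third-order condition\<close>

theorem proposition3p5:
  fixes f :: "'g::finite \<Rightarrow> 'g \<Rightarrow> 'g \<Rightarrow> real"
    and cF :: real
    and O2 :: "'g obst2"
    and Ow2 :: "4 \<Rightarrow> 'g \<Rightarrow> 'g expr"
    and N :: "'g expr set"
    and dc :: "'g expr \<Rightarrow> 'g expr"
  assumes "simple_lie_algebra f"
    and "two_point_obstructions f cF O2"
    and "expression_identities N"
    and "string_variation N dc"
  shows "sym3 (dpart (O_Q1_L2 f cF O2) * delta X1 X2 + dpart (O_Q2d_L1 f cF O2)) \<in> N \<and>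
    (total_derivative N (sym3 (second_term f O2 + spart (O_Q1_L2 f cF O2) * delta X1 X2)) \<longrightarrow>
     total_derivative N (sym3 (first_term f Ow2 + spart (O_Q2d_L1 f cF O2))) \<longrightarrow>
     (\<exists>Q3. (\<forall>\<mu>. three_point (Q3 \<mu>)) \<and> (\<forall>\<mu>. dpart (Q3 \<mu>) = 0) \<and>
           third_order_condition N dc f cF O2 Ow2 0 Q3))"
proof (intro conjI impI)
  interpret vanishing_expressions N by unfold_locales (fact assms(3))
  let ?s = "sym3 (dpart (O_Q1_L2 f cF O2) * delta X1 X2 + dpart (O_Q2d_L1 f cF O2))"
  let ?e1 = "sym3 (second_term f O2 + spart (O_Q1_L2 f cF O2) * delta X1 X2)"
  let ?e2 = "sym3 (first_term f Ow2 + spart (O_Q2d_L1 f cF O2))"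
  show s: "?s \<in> N"
    using first_contribution_vanishes[OF assms(1,2)] second_contribution_vanishes[OF assms(1,2)]
    by (intro N_sym3 N_add N_mult_right)
  assume e1: "total_derivative N ?e1" and e2: "total_derivative N ?e2"
  obtain V1 where V1: "\<forall>\<mu>. three_point (V1 \<mu>) \<and> dpart (V1 \<mu>) = 0" "?e1 - div_sym V1 \<in> N"
    using total_derivative_string_integrated[OF e1] .
  obtain V2 where V2: "\<forall>\<mu>. three_point (V2 \<mu>) \<and> dpart (V2 \<mu>) = 0" "?e2 - div_sym V2 \<in> N"
    using total_derivative_string_integrated[OF e2] .
  \<comment> \<open>The factor is the 3 of the third-order condition, negative because the
    divergence of Q_3 is subtracted there.\<close>
  define Q3 where "Q3 \<mu> = cst (- 3) * (V1 \<mu> + V2 \<mu>)" for \<mu>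
  have div_Q3: "div_sym Q3 = - cst 3 * (div_sym V1 + div_sym V2)"
    unfolding Q3_def div_sym_mult_cst div_sym_add by (simp only: cst_uminus)
  \<comment> \<open>Additivity alone makes the variation of L_3 = 0 vanish.\<close>
  have "dc 0 + dc 0 = dc 0"
    using assms(4) unfolding string_variation_def by (metis add_0)
  then have dc0: "dc 0 = 0" by simp
  \<comment> \<open>Regrouping: the first bracket vanishes by the first claim, the other two are the
    assumed total derivatives.\<close>
  have "O_Q1_L2 f cF O2 * delta X1 X2 + O_Q2_L1 f cF O2 Ow2
      = (dpart (O_Q1_L2 f cF O2) * delta X1 X2 + dpart (O_Q2d_L1 f cF O2))
        + (second_term f O2 + spart (O_Q1_L2 f cF O2) * delta X1 X2)
        + (first_term f Ow2 + spart (O_Q2d_L1 f cF O2))"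
    unfolding O_Q2_L1_def spart_def by (simp add: algebra_simps)
  then have "cst 3 * sym3 (O_Q1_L2 f cF O2 * delta X1 X2 + O_Q2_L1 f cF O2 Ow2)
        - (dc 0 * (delta X0 X1 * delta X1 X2) - div_sym Q3)
      = cst 3 * (?s + (?e1 - div_sym V1) + (?e2 - div_sym V2))"
    unfolding div_Q3 dc0 by (simp add: sym3_add algebra_simps)
  moreover have "\<dots> \<in> N"
    using s V1(2) V2(2) by (intro N_mult N_add)
  ultimately have "third_order_condition N dc f cF O2 Ow2 0 Q3"
    unfolding third_order_condition_def by simp
  moreover have "\<forall>\<mu>. three_point (Q3 \<mu>)"
    unfolding Q3_def using V1(1) V2(1) by (blast intro: three_point_mult_cst three_point_add)
  moreover have "\<forall>\<mu>. dpart (Q3 \<mu>) = 0"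
    unfolding Q3_def by (simp add: dpart_mult dpart_add V1(1) V2(1))
  ultimately show "\<exists>Q3. (\<forall>\<mu>. three_point (Q3 \<mu>)) \<and> (\<forall>\<mu>. dpart (Q3 \<mu>) = 0) \<and>
      third_order_condition N dc f cF O2 Ow2 0 Q3"
    by blast
qed

end
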